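(* Let $\pi$ be a 1-block factor code from an irreducible 1-step shift of finite type $X$ onto a sofic shift $Y$, and let $d$ be a positive integer. The following are equivalent: (1) $\pi$ is constant-class-to-one with $d_\pi=d$. (2) There is $N>0$ such that all words in $\mathcal{B}_N(Y)$ have the minimal depth $d$; that is, $d=\min_{w\in\mathcal{B}(Y)}d_\pi(w)$ and $d_\pi(w)=d$ for every $w\in\mathcal{B}_N(Y)$. (3) There is $N>0$ such that all words in $\mathcal{B}_N(Y)$ have the minimal t-depth $d$; that is, $d=\min_{w\in\mathcal{B}(Y)}\tau_\pi(w)$ and $\tau_\pi(w)=d$ for every $w\in\mathcal{B}_N(Y)$. If any of these three conditions holds, then $\pi$ is bi-class-closing and bi-continuing.
   Context: Shift spaces are closed shift-invariant subsets of $\mathcal{A}^{\mathbb{Z}}$ for a finite alphabet; $X$ has alphabet $\mathcal{A}$. $\mathcal{B}(X)$ is the set of words occurring in points of $X$, $\mathcal{B}_n(X)$ those of length $n$. $X$ is irreducible if for all $u,v\in\mathcal{B}(X)$ there is $w$ with $uwv\in\mathcal{B}(X)$. $X$ is a 1-step shift of finite type if for every symbol $w\in\mathcal{B}_1(X)$: $uw,wv\in\mathcal{B}(X)$ implies $uwv\in\mathcal{B}(X)$. A factor code is a continuous shift-commuting surjection; it is 1-block if $x|_0$ determines $\pi(x)|_0$, in which case it acts on words symbol by symbol, giving a map $\pi:\mathcal{B}(X)\to\mathcal{B}(Y)$. A sofic shift is a factor of a shift of finite type. Two points $x,x'$ are left (resp. right) asymptotic if $x|_{(-\infty,n]}=x'|_{(-\infty,n]}$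 (resp. $x|_{[n,\infty)}=x'|_{[n,\infty)}$) for some $n\in\mathbb{Z}$. Let $x,x'\in X$ with $\pi(x)=\pi(x')$ and $m\in\mathbb{Z}$. A right $m$-bridge from $x$ to $x'$ is a point $z\in X$ with $\pi(z)=\pi(x)$ such that for some $n>m$, $z|_{(-\infty,m]}=x|_{(-\infty,m]}$ and $z|_{[n,\infty)}=x'|_{[n,\infty)}$. A left $m$-bridge from $x$ to $x'$ is a point $z\in X$ with $\pi(z)=\pi(x)$ such that for some $n<m$, $z|_{(-\infty,n]}=x'|_{(-\infty,n]}$ and $z|_{[m,\infty)}=x|_{[m,\infty)}$. Write $x\to^r x'$ (resp. $x\to^l x'$) if for every $m\in\mathbb{Z}$ there is a right (resp. left) $m$-bridge from $x$ to $x'$. Points $x,x'$ in the same fibre are right equivalent if $x\to^r x'$ and $x'\to^r x$, and left equivalent if $x\to^l x'$ and $x'\to^l x$. For $y\in Y$, $d_\pi^r(y)$ is the number of right equivalence classes in $\pi^{-1}(y)$ (always finite); the class degree is $d_\pi=\min_{y\in Y}d_\pi^r(y)$. $\pi$ is constant-class-to-one if $d_\pi^r(y)=d_\pi$ for all $y\in Y$. Depth. A word $u\in\mathcal{B}_l(X)$ is routable through $M\subset\mathcal{A}$ at $n$, $1<n<l$, if there is $v\in\mathcal{B}_l(X)$ with $v|_1=u|_1$, $v|_l=u|_l$, $\pi(v)=\pi(u)$ and $v|_n\in M$. A word $w\in\mathcal{B}_l(Y)$ is fibre-routable through $M$ at $n$ if all words in $\pi^{-1}(w)\subset\mathcal{B}_l(X)$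 are routable through $M$ at $n$. The depth of $w$ is $d_\pi(w)=\min_{1<n<l}\min\{|M| : w\text{ is fibre-routable through }M\text{ at }n\}$ (with value $+\infty$ if there is no $n$ with $1<n<l$). t-depth. For $u,w\in\mathcal{B}_l(X)$ with $\pi(u)=\pi(w)$, a bridge from $u$ to $w$ is a word $v\in\mathcal{B}_l(X)$ with $v|_1=u|_1$, $v|_l=w|_l$, $\pi(v)=\pi(u)=\pi(w)$; a 2-way bridge between $u$ and $w$ is a bridge from $u$ to $w$ together with a bridge from $w$ to $u$. A subset of $\pi^{-1}(w)$, $w\in\mathcal{B}(Y)$, is tangled if between any two of its words there is a 2-way bridge. The t-depth $\tau_\pi(w)$ is the smallest cardinality of a partition of $\pi^{-1}(w)$ into tangled sets. $\pi$ is right (resp. left) class-closing if any two left (resp. right) asymptotic points $x,x'\in X$ with $\pi(x)=\pi(x')$ are right (resp. left) equivalent; bi-class-closing means both. $\pi$ is right (resp. left) continuing if for all $x\in X$ and all $y\in Y$ left (resp. right) asymptotic to $\pi(x)$ there is a preimage of $y$ that is left (resp. right) asymptotic to $x$; bi-continuing means both. *)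

theory Defs
  imports "HOL-Analysis.Analysis"
begin

section \<open>Shift spaces and their words\<close>

definition full_shift :: "'a set \<Rightarrow> (int \<Rightarrow> 'a) topology" where
  "full_shift A = product_topology (\<lambda>_. discrete_topology A) UNIV"

definition shift_map :: "(int \<Rightarrow> 'a) \<Rightarrow> (int \<Rightarrow> 'a)" where
  "shift_map x = (\<lambda>i. x (i + 1))"

definition shift_space :: "'a set \<Rightarrow> (int \<Rightarrow> 'a) set \<Rightarrow> bool" where
  "shift_space A X \<longleftrightarrow> finite A \<and> closedin (full_shift A) X \<and> shift_map ` X = X"

definition word_at :: "(int \<Rightarrow> 'a) \<Rightarrow> int \<Rightarrow> nat \<Rightarrow> 'a list" where
  "word_at x i n = map (\<lambda>k. x (i + int k)) [0..<n]"

definition words :: "(int \<Rightarrow> 'a) set \<Rightarrow> nat \<Rightarrow> 'a list set" where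
  "words X n = {word_at x i n | x i. x \<in> X}"

text \<open>The language consists of nonempty words. Minima over the language occur below,
  and the first and last symbols of a word enter the quantities that are minimised, so
  the empty word has to be left out.\<close>

definition language :: "(int \<Rightarrow> 'a) set \<Rightarrow> 'a list set" where
  "language X = (\<Union>n\<in>{1..}. words X n)"

definition irreducible_shift :: "(int \<Rightarrow> 'a) set \<Rightarrow> bool" where
  "irreducible_shift X \<longleftrightarrow>
     (\<forall>u\<in>language X. \<forall>v\<in>language X. \<exists>w. u @ w @ v \<in> language X)"

definition one_step_sft :: "'a set \<Rightarrow> (int \<Rightarrow> 'a) set \<Rightarrow> bool" where
  "one_step_sft A X \<longleftrightarrow> shift_space A X \<and>
     (\<forall>w u v. w \<in> words X 1 \<longrightarrow> u @ w \<in> language X \<longrightarrow> w @ v \<in> language X \<longrightarrow>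
        u @ w @ v \<in> language X)"

definition shift_of_finite_type :: "'a set \<Rightarrow> (int \<Rightarrow> 'a) set \<Rightarrow> bool" where
  "shift_of_finite_type A X \<longleftrightarrow> finite A \<and>
     (\<exists>F. finite F \<and>
        X = {x \<in> topspace (full_shift A). \<forall>w\<in>F. \<forall>i. word_at x i (length w) \<noteq> w})"


section \<open>Factor codes\<close>

definition factor_code ::
  "'a set \<Rightarrow> (int \<Rightarrow> 'a) set \<Rightarrow> 'b set \<Rightarrow> (int \<Rightarrow> 'b) set \<Rightarrow> ((int \<Rightarrow> 'a) \<Rightarrow> (int \<Rightarrow> 'b)) \<Rightarrow> bool" where
  "factor_code A X B Y \<pi> \<longleftrightarrow>
     continuous_map (subtopology (full_shift A) X) (subtopology (full_shift B) Y) \<pi> \<and>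
     (\<forall>x\<in>X. \<pi> (shift_map x) = shift_map (\<pi> x)) \<and>
     \<pi> ` X = Y"

text \<open>A type cannot be quantified existentially, so the covering shift of finite type has
  its alphabet in \<^typ>\<open>nat\<close>; every finite alphabet can be renamed to such a one.\<close>

definition sofic_shift :: "'b set \<Rightarrow> (int \<Rightarrow> 'b) set \<Rightarrow> bool" where
  "sofic_shift B Y \<longleftrightarrow> shift_space B Y \<and>
     (\<exists>(A :: nat set) X \<phi>. shift_of_finite_type A X \<and> factor_code A X B Y \<phi>)"

definition one_block :: "(int \<Rightarrow> 'a) set \<Rightarrow> ((int \<Rightarrow> 'a) \<Rightarrow> (int \<Rightarrow> 'b)) \<Rightarrow> bool" where
  "one_block X \<pi> \<longleftrightarrow> (\<forall>x\<in>X. \<forall>x'\<in>X. x 0 = x' 0 \<longrightarrow> \<pi> x 0 = \<pi> x' 0)"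

text \<open>For a 1-block code the value is unique for every symbol that occurs in \<open>X\<close>.\<close>

definition symbol_map :: "(int \<Rightarrow> 'a) set \<Rightarrow> ((int \<Rightarrow> 'a) \<Rightarrow> (int \<Rightarrow> 'b)) \<Rightarrow> 'a \<Rightarrow> 'b" where
  "symbol_map X \<pi> a = (THE b. \<exists>x\<in>X. x 0 = a \<and> \<pi> x 0 = b)"

definition word_map :: "(int \<Rightarrow> 'a) set \<Rightarrow> ((int \<Rightarrow> 'a) \<Rightarrow> (int \<Rightarrow> 'b)) \<Rightarrow> 'a list \<Rightarrow> 'b list" where
  "word_map X \<pi> u = map (symbol_map X \<pi>) u"

definition fibre :: "(int \<Rightarrow> 'a) set \<Rightarrow> ((int \<Rightarrow> 'a) \<Rightarrow> (int \<Rightarrow> 'b)) \<Rightarrow> (int \<Rightarrow> 'b) \<Rightarrow> (int \<Rightarrow> 'a) set" where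
  "fibre X \<pi> y = {x \<in> X. \<pi> x = y}"

definition word_fibre :: "(int \<Rightarrow> 'a) set \<Rightarrow> ((int \<Rightarrow> 'a) \<Rightarrow> (int \<Rightarrow> 'b)) \<Rightarrow> 'b list \<Rightarrow> 'a list set" where
  "word_fibre X \<pi> w = {u \<in> words X (length w). word_map X \<pi> u = w}"


section \<open>Bridges and class degree\<close>

text \<open>Cardinalities and minima take values in \<^typ>\<open>enat\<close>: an infinite set has cardinality
  \<open>\<infinity>\<close>, and the minimum of an empty set is \<open>\<infinity>\<close>. A nonempty infimum is attained.\<close>

definition ecard :: "'a set \<Rightarrow> enat" where
  "ecard S = (if finite S then enat (card S) else \<infinity>)"

definition right_bridge ::
  "(int \<Rightarrow> 'a) set \<Rightarrow> ((int \<Rightarrow> 'a) \<Rightarrow> (int \<Rightarrow> 'b)) \<Rightarrow> int \<Rightarrow> (int \<Rightarrow> 'a) \<Rightarrow> (int \<Rightarrow> 'a) \<Rightarrow> (int \<Rightarrow> 'a) \<Rightarrow> bool" where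
  "right_bridge X \<pi> m x x' z \<longleftrightarrow> z \<in> X \<and> \<pi> z = \<pi> x \<and>
     (\<exists>n>m. (\<forall>i\<le>m. z i = x i) \<and> (\<forall>i\<ge>n. z i = x' i))"

definition left_bridge ::
  "(int \<Rightarrow> 'a) set \<Rightarrow> ((int \<Rightarrow> 'a) \<Rightarrow> (int \<Rightarrow> 'b)) \<Rightarrow> int \<Rightarrow> (int \<Rightarrow> 'a) \<Rightarrow> (int \<Rightarrow> 'a) \<Rightarrow> (int \<Rightarrow> 'a) \<Rightarrow> bool" where
  "left_bridge X \<pi> m x x' z \<longleftrightarrow> z \<in> X \<and> \<pi> z = \<pi> x \<and>
     (\<exists>n<m. (\<forall>i\<le>n. z i = x' i) \<and> (\<forall>i\<ge>m. z i = x i))"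

definition right_reach ::
  "(int \<Rightarrow> 'a) set \<Rightarrow> ((int \<Rightarrow> 'a) \<Rightarrow> (int \<Rightarrow> 'b)) \<Rightarrow> (int \<Rightarrow> 'a) \<Rightarrow> (int \<Rightarrow> 'a) \<Rightarrow> bool" where
  "right_reach X \<pi> x x' \<longleftrightarrow> (\<forall>m. \<exists>z. right_bridge X \<pi> m x x' z)"

definition left_reach ::
  "(int \<Rightarrow> 'a) set \<Rightarrow> ((int \<Rightarrow> 'a) \<Rightarrow> (int \<Rightarrow> 'b)) \<Rightarrow> (int \<Rightarrow> 'a) \<Rightarrow> (int \<Rightarrow> 'a) \<Rightarrow> bool" where
  "left_reach X \<pi> x x' \<longleftrightarrow> (\<forall>m. \<exists>z. left_bridge X \<pi> m x x' z)"

definition right_equivalent ::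
  "(int \<Rightarrow> 'a) set \<Rightarrow> ((int \<Rightarrow> 'a) \<Rightarrow> (int \<Rightarrow> 'b)) \<Rightarrow> (int \<Rightarrow> 'a) \<Rightarrow> (int \<Rightarrow> 'a) \<Rightarrow> bool" where
  "right_equivalent X \<pi> x x' \<longleftrightarrow> x \<in> X \<and> x' \<in> X \<and> \<pi> x = \<pi> x' \<and>
     right_reach X \<pi> x x' \<and> right_reach X \<pi> x' x"

definition left_equivalent ::
  "(int \<Rightarrow> 'a) set \<Rightarrow> ((int \<Rightarrow> 'a) \<Rightarrow> (int \<Rightarrow> 'b)) \<Rightarrow> (int \<Rightarrow> 'a) \<Rightarrow> (int \<Rightarrow> 'a) \<Rightarrow> bool" where
  "left_equivalent X \<pi> x x' \<longleftrightarrow> x \<in> X \<and> x' \<in> X \<and> \<pi> x = \<pi> x' \<and>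
     left_reach X \<pi> x x' \<and> left_reach X \<pi> x' x"

definition num_right_classes ::
  "(int \<Rightarrow> 'a) set \<Rightarrow> ((int \<Rightarrow> 'a) \<Rightarrow> (int \<Rightarrow> 'b)) \<Rightarrow> (int \<Rightarrow> 'b) \<Rightarrow> enat" where
  "num_right_classes X \<pi> y = ecard (fibre X \<pi> y // {(x, x'). right_equivalent X \<pi> x x'})"

definition class_degree ::
  "(int \<Rightarrow> 'a) set \<Rightarrow> (int \<Rightarrow> 'b) set \<Rightarrow> ((int \<Rightarrow> 'a) \<Rightarrow> (int \<Rightarrow> 'b)) \<Rightarrow> enat" where
  "class_degree X Y \<pi> = (INF y\<in>Y. num_right_classes X \<pi> y)"

definition constant_class_to_one ::
  "(int \<Rightarrow> 'a) set \<Rightarrow> (int \<Rightarrow> 'b) set \<Rightarrow> ((int \<Rightarrow> 'a) \<Rightarrow> (int \<Rightarrow> 'b)) \<Rightarrow> bool" where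
  "constant_class_to_one X Y \<pi> \<longleftrightarrow>
     (\<forall>y\<in>Y. num_right_classes X \<pi> y = class_degree X Y \<pi>)"


section \<open>Depth and t-depth\<close>

text \<open>Positions in words are counted from 1, so the symbol of \<open>v\<close> at \<open>n\<close> is \<open>v ! (n - 1)\<close>.\<close>

definition routable ::
  "(int \<Rightarrow> 'a) set \<Rightarrow> ((int \<Rightarrow> 'a) \<Rightarrow> (int \<Rightarrow> 'b)) \<Rightarrow> 'a list \<Rightarrow> 'a set \<Rightarrow> nat \<Rightarrow> bool" where
  "routable X \<pi> u M n \<longleftrightarrow>
     (\<exists>v\<in>words X (length u). hd v = hd u \<and> last v = last u \<and>
        word_map X \<pi> v = word_map X \<pi> u \<and> v ! (n - 1) \<in> M)"

definition fibre_routable ::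
  "(int \<Rightarrow> 'a) set \<Rightarrow> ((int \<Rightarrow> 'a) \<Rightarrow> (int \<Rightarrow> 'b)) \<Rightarrow> 'b list \<Rightarrow> 'a set \<Rightarrow> nat \<Rightarrow> bool" where
  "fibre_routable X \<pi> w M n \<longleftrightarrow> (\<forall>u\<in>word_fibre X \<pi> w. routable X \<pi> u M n)"

definition depth ::
  "'a set \<Rightarrow> (int \<Rightarrow> 'a) set \<Rightarrow> ((int \<Rightarrow> 'a) \<Rightarrow> (int \<Rightarrow> 'b)) \<Rightarrow> 'b list \<Rightarrow> enat" where
  "depth A X \<pi> w = (INF n\<in>{n. 1 < n \<and> n < length w}.
     INF M\<in>{M. M \<subseteq> A \<and> fibre_routable X \<pi> w M n}. ecard M)"

definition word_bridge ::
  "(int \<Rightarrow> 'a) set \<Rightarrow> ((int \<Rightarrow> 'a) \<Rightarrow> (int \<Rightarrow> 'b)) \<Rightarrow> 'a list \<Rightarrow> 'a list \<Rightarrow> 'a list \<Rightarrow> bool" where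
  "word_bridge X \<pi> u w v \<longleftrightarrow> v \<in> words X (length u) \<and> hd v = hd u \<and> last v = last w \<and>
     word_map X \<pi> v = word_map X \<pi> u \<and> word_map X \<pi> v = word_map X \<pi> w"

definition tangled ::
  "(int \<Rightarrow> 'a) set \<Rightarrow> ((int \<Rightarrow> 'a) \<Rightarrow> (int \<Rightarrow> 'b)) \<Rightarrow> 'a list set \<Rightarrow> bool" where
  "tangled X \<pi> S \<longleftrightarrow>
     (\<forall>u\<in>S. \<forall>w\<in>S. (\<exists>v. word_bridge X \<pi> u w v) \<and> (\<exists>v. word_bridge X \<pi> w u v))"

definition t_depth ::
  "(int \<Rightarrow> 'a) set \<Rightarrow> ((int \<Rightarrow> 'a) \<Rightarrow> (int \<Rightarrow> 'b)) \<Rightarrow> 'b list \<Rightarrow> enat" where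
  "t_depth X \<pi> w =
     (INF P\<in>{P. partition_on (word_fibre X \<pi> w) P \<and> (\<forall>S\<in>P. tangled X \<pi> S)}. ecard P)"


section \<open>Class-closing and continuing codes\<close>

definition left_asymptotic :: "(int \<Rightarrow> 'a) \<Rightarrow> (int \<Rightarrow> 'a) \<Rightarrow> bool" where
  "left_asymptotic x x' \<longleftrightarrow> (\<exists>n. \<forall>i\<le>n. x i = x' i)"

definition right_asymptotic :: "(int \<Rightarrow> 'a) \<Rightarrow> (int \<Rightarrow> 'a) \<Rightarrow> bool" where
  "right_asymptotic x x' \<longleftrightarrow> (\<exists>n. \<forall>i\<ge>n. x i = x' i)"

definition right_class_closing :: "(int \<Rightarrow> 'a) set \<Rightarrow> ((int \<Rightarrow> 'a) \<Rightarrow> (int \<Rightarrow> 'b)) \<Rightarrow> bool" where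
  "right_class_closing X \<pi> \<longleftrightarrow>
     (\<forall>x\<in>X. \<forall>x'\<in>X. left_asymptotic x x' \<longrightarrow> \<pi> x = \<pi> x' \<longrightarrow> right_equivalent X \<pi> x x')"

definition left_class_closing :: "(int \<Rightarrow> 'a) set \<Rightarrow> ((int \<Rightarrow> 'a) \<Rightarrow> (int \<Rightarrow> 'b)) \<Rightarrow> bool" where
  "left_class_closing X \<pi> \<longleftrightarrow>
     (\<forall>x\<in>X. \<forall>x'\<in>X. right_asymptotic x x' \<longrightarrow> \<pi> x = \<pi> x' \<longrightarrow> left_equivalent X \<pi> x x')"

definition bi_class_closing :: "(int \<Rightarrow> 'a) set \<Rightarrow> ((int \<Rightarrow> 'a) \<Rightarrow> (int \<Rightarrow> 'b)) \<Rightarrow> bool" where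
  "bi_class_closing X \<pi> \<longleftrightarrow> right_class_closing X \<pi> \<and> left_class_closing X \<pi>"

definition right_continuing ::
  "(int \<Rightarrow> 'a) set \<Rightarrow> (int \<Rightarrow> 'b) set \<Rightarrow> ((int \<Rightarrow> 'a) \<Rightarrow> (int \<Rightarrow> 'b)) \<Rightarrow> bool" where
  "right_continuing X Y \<pi> \<longleftrightarrow>
     (\<forall>x\<in>X. \<forall>y\<in>Y. left_asymptotic y (\<pi> x) \<longrightarrow> (\<exists>x'\<in>fibre X \<pi> y. left_asymptotic x' x))"

definition left_continuing ::
  "(int \<Rightarrow> 'a) set \<Rightarrow> (int \<Rightarrow> 'b) set \<Rightarrow> ((int \<Rightarrow> 'a) \<Rightarrow> (int \<Rightarrow> 'b)) \<Rightarrow> bool" where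
  "left_continuing X Y \<pi> \<longleftrightarrow>
     (\<forall>x\<in>X. \<forall>y\<in>Y. right_asymptotic y (\<pi> x) \<longrightarrow> (\<exists>x'\<in>fibre X \<pi> y. right_asymptotic x' x))"

definition bi_continuing ::
  "(int \<Rightarrow> 'a) set \<Rightarrow> (int \<Rightarrow> 'b) set \<Rightarrow> ((int \<Rightarrow> 'a) \<Rightarrow> (int \<Rightarrow> 'b)) \<Rightarrow> bool" where
  "bi_continuing X Y \<pi> \<longleftrightarrow> right_continuing X Y \<pi> \<and> left_continuing X Y \<pi>"

end

theory Submission
  imports Defs
begin

text \<open>
  Of a preimage of a word only the two end symbols matter, so let \<open>ends w\<close> be the relation of all
  pairs (first symbol, last symbol) of preimages of \<open>w\<close>. A partition of the preimages into \<open>k\<close>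
  tangled sets is the same as a cover of \<open>ends w\<close> by \<open>k\<close> rectangles, that is, a factorisation
  of this relation through a set with \<open>k\<close> elements (\<open>t_depth_le_iff\<close>): the t-depth is a Boolean
  rank. Routing through a set \<open>M\<close> at an interior position is a factorisation of the special form in
  which the middle set is \<open>M\<close> and the factors are those of the two halves of the word
  (\<open>depth_le_iff\<close>). Hence the t-depth is at most the depth.

  Numbers of right classes are tied to these ranks as follows. If the fibre of \<open>y\<close> has at most \<open>k\<close>
  classes, then a long window of \<open>y\<close> has depth at most \<open>k\<close>: one representative of each class
  gives \<open>k\<close> symbols at a common time, every point of the fibre can visit one of them and return,
  and compactness bounds the time this takes (\<open>depth_window_le\<close>). Compactness of \<open>X\<close> turns such
  a bound for all points into a bound for all words of one length (\<open>uniform_depth_bound\<close>).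
  Conversely, if words of t-depth at most \<open>k\<close> recur in \<open>y\<close> arbitrarily far to the right, then among
  \<open>k + 1\<close> points over \<open>y\<close> two share a rectangle infinitely often, so there are at most \<open>k\<close>
  classes (\<open>num_right_classes_le\<close>); by irreducibility a periodic \<open>y\<close> of this kind exists for every
  word of t-depth at most \<open>k\<close>. Only the inequality between t-depth and depth enters the
  combination of these facts, so any quantity between the two satisfies the same equivalence with
  the condition on classes (\<open>uniform_minimum_iff\<close>); depth and t-depth are the two extreme cases.

  For closing and continuing, suppose that no word has t-depth below \<open>d\<close> and that two disjoint
  windows are routed through \<open>d\<close>-element sets \<open>M1\<close> and \<open>M2\<close>. Then the paths over the
  stretch between the two positions connect each symbol of \<open>M1\<close> with exactly one symbol of \<open>M2\<close>
  and vice versa (\<open>routes_matching_unique\<close>). Rank \<open>d\<close> gives a bijection of connected symbols by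
  Hall's theorem. A further connected pair could be closed up by irreducibility to a cycle in which
  two of the \<open>d\<close> symbols reach each other; in a high power of the cycle these two have the same
  successors, and the rank has dropped below \<open>d\<close>. Two points over \<open>y\<close> that agree at one time
  therefore pass to each other in every window to the left or to the right of it
  (\<open>meeting_points_reach\<close>), which is closing, and no path into \<open>M1\<close> dies out
  (\<open>reach_extend\<close>), which by compactness is continuing. Since matchings are symmetric in
  time, the left and right versions come from the same lemma.
\<close>

section \<open>Boolean rank\<close>

text \<open>A factorisation \<open>U O Id_on {..<k} O V\<close> is a union of the \<open>k\<close> rectangles (column of \<open>U\<close>)
  \<open>\<times>\<close> (row of \<open>V\<close>). Written as a product, the bound passes to every relation that has \<open>R\<close>
  as a factor.\<close>

definition boolean_rank_le :: "('a \<times> 'b) set \<Rightarrow> nat \<Rightarrow> bool" where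
  "boolean_rank_le R k \<longleftrightarrow> (\<exists>U V. R = U O Id_on {..<k} O V)"

lemma boolean_rank_le_factor:
  assumes "R = U O Id_on M O V" "finite M" "card M \<le> k"
  shows "boolean_rank_le R k"
proof -
  obtain g where g: "bij_betw g M {..<card M}"
    using ex_bij_betw_finite_nat[OF assms(2)] by (auto simp: atLeast0LessThan)
  let ?U = "{(a, g e) | a e. (a, e) \<in> U \<and> e \<in> M}" and ?V = "{(g e, c) | e c. (e, c) \<in> V \<and> e \<in> M}"
  have inj: "inj_on g M" using g by (simp add: bij_betw_def)
  have lt: "g e < k" if "e \<in> M" for e
  proof -
    have "g e < card M" using bij_betwE[OF g] that by auto
    then show ?thesis using assms(3) by simp
  qed
  have "R = ?U O Id_on {..<k} O ?V"
  proof (intro set_eqI iffI)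
    fix x assume "x \<in> R"
    then show "x \<in> ?U O Id_on {..<k} O ?V"
      unfolding assms(1) using lt by (auto simp: relcomp_unfold Id_on_iff)
  next
    fix x assume "x \<in> ?U O Id_on {..<k} O ?V"
    then obtain a c e e' where "x = (a, c)" "g e = g e'" "(a, e) \<in> U" "(e', c) \<in> V" "e \<in> M" "e' \<in> M"
      by (auto simp: Id_on_iff)
    moreover from this have "e = e'" using inj by (auto dest: inj_onD)
    ultimately show "x \<in> R" unfolding assms(1) by auto
  qed
  then show ?thesis unfolding boolean_rank_le_def by blast
qed

lemma boolean_rank_le_relcomp:
  assumes "boolean_rank_le R k"
  shows "boolean_rank_le (Q O R O S) k"
proof -
  from assms obtain U V where "R = U O Id_on {..<k} O V"
    unfolding boolean_rank_le_def by blast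
  then have "Q O R O S = (Q O U) O Id_on {..<k} O (V O S)"
    by (simp add: O_assoc)
  then show ?thesis unfolding boolean_rank_le_def by blast
qed

section \<open>Matchings in relations of full Boolean rank\<close>

text \<open>Hall's marriage theorem, after Halmos and Vaughan. If some proper nonempty subset \<open>J\<close> is tight,
  then \<open>J\<close> and its complement, with the neighbours of \<open>J\<close> removed, are matched separately. If
  there is none, any one pair can be matched first, since each other subset has a neighbour to spare.\<close>

lemma hall:
  fixes H :: "('a \<times> 'b) set"
  assumes "finite I" "finite (H `` I)" "\<And>J. J \<subseteq> I \<Longrightarrow> card J \<le> card (H `` J)"
  shows "\<exists>h. inj_on h I \<and> (\<forall>i\<in>I. (i, h i) \<in> H)"
  using assms
proof (induction I arbitrary: H rule: finite_psubset_induct)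
  case (psubset I)
  note fin = psubset.prems(1) and le = psubset.prems(2)
  have finJ: "finite (H `` J)" if "J \<subseteq> I" for J
    by (rule finite_subset[OF _ fin]) (use that in auto)
  show ?case
  proof (cases "\<exists>J. J \<noteq> {} \<and> J \<subset> I \<and> card (H `` J) \<le> card J")
    case True
    then obtain J where J: "J \<noteq> {}" "J \<subset> I" "card (H `` J) \<le> card J" by blast
    \<comment> \<open>Outside \<open>J\<close> only partners that are not neighbours of \<open>J\<close> may be used.\<close>
    let ?H = "H \<inter> (UNIV \<times> - (H `` J))"
    obtain h1 where h1: "inj_on h1 J" "\<forall>i\<in>J. (i, h1 i) \<in> H"
      using psubset.IH[OF J(2), of H] finJ le J(2) by (metis psubset_imp_subset subset_trans)
    have le': "card K \<le> card (?H `` K)" if K: "K \<subseteq> I - J" for K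
    proof -
      have finK: "finite K" and finJ': "finite J" using K J psubset.hyps by (auto intro: finite_subset)
      have "card J + card K = card (J \<union> K)"
        using K finK finJ' by (subst card_Un_disjoint) auto
      also have "\<dots> \<le> card (H `` (J \<union> K))" using K J by (intro le) auto
      also have "H `` (J \<union> K) = H `` J \<union> ?H `` K" by auto
      also have "card \<dots> \<le> card (H `` J) + card (?H `` K)" by (rule card_Un_le)
      finally show ?thesis using J(3) by linarith
    qed
    have "I - J \<subset> I" using J by auto
    moreover have "finite (?H `` (I - J))" by (rule finite_subset[OF _ fin]) auto
    ultimately obtain h2 where h2: "inj_on h2 (I - J)" "\<forall>i\<in>I - J. (i, h2 i) \<in> ?H"
      using psubset.IH[of "I - J" ?H] le' by metis
    let ?h = "\<lambda>i. if i \<in> J then h1 i else h2 i"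
    have "inj_on ?h I"
    proof (rule inj_onI)
      fix i j assume ij: "i \<in> I" "j \<in> I" "?h i = ?h j"
      then consider "i \<in> J" "j \<in> J" | "i \<notin> J" "j \<notin> J" | "i \<in> J" "j \<notin> J" | "i \<notin> J" "j \<in> J" by blast
      then show "i = j"
      proof cases
        case 1 then show ?thesis using ij h1(1) by (simp add: inj_on_def)
      next
        case 2 then show ?thesis using ij h2(1) by (simp add: inj_on_def)
      next
        case 3 then show ?thesis using ij h1(2) h2(2) by fastforce
      next
        case 4
        then have eq: "h2 i = h1 j" using ij(3) by simp
        have "h1 j \<in> H `` J" using 4(2) ij(2) h1(2) by blast
        moreover have "h2 i \<notin> H `` J" using 4(1) ij(1) h2(2) by blast
        ultimately show ?thesis using eq by simp
      qed
    qed
    moreover have "\<forall>i\<in>I. (i, ?h i) \<in> H" using h1(2) h2(2) by auto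
    ultimately show ?thesis by blast
  next
    case False
    show ?thesis
    proof (cases "I = {}")
      case True then show ?thesis by simp
    next
      case I: False
      then obtain i where i: "i \<in> I" by blast
      have "card {i} \<le> card (H `` {i})" using i by (intro le) auto
      then obtain b where b: "(i, b) \<in> H" by (cases "H `` {i} = {}") auto
      let ?H = "H \<inter> (UNIV \<times> - {b})"
      \<comment> \<open>Removing \<open>b\<close> costs at most one neighbour, and no subset is tight.\<close>
      have le': "card K \<le> card (?H `` K)" if K: "K \<subseteq> I - {i}" for K
      proof (cases "K = {}")
        case False
        then have "card K < card (H `` K)"
          using K i \<open>\<not> (\<exists>J. J \<noteq> {} \<and> J \<subset> I \<and> card (H `` J) \<le> card J)\<close>
          by (metis Diff_iff insertCI not_le psubsetI subset_Diff_insert subset_iff)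
        moreover have eq: "?H `` K = H `` K - {b}" by auto
        moreover have "card (H `` K) - 1 \<le> card (H `` K - {b})" using card_Diff1_le
          by (metis One_nat_def card_Diff_singleton_if diff_le_self order_refl)
        ultimately show ?thesis unfolding eq by linarith
      qed simp
      have "I - {i} \<subset> I" using i by auto
      moreover have "finite (?H `` (I - {i}))" by (rule finite_subset[OF _ fin]) auto
      ultimately obtain h where h: "inj_on h (I - {i})" "\<forall>j\<in>I - {i}. (j, h j) \<in> ?H"
        using psubset.IH[of "I - {i}" ?H] le' by metis
      have "inj_on (h(i := b)) (insert i (I - {i}))"
        by (rule inj_on_insert[THEN iffD2]) (use h in \<open>auto simp: inj_on_def image_iff\<close>)
      then have "inj_on (h(i := b)) I" using i by (simp add: insert_absorb)
      moreover have "\<forall>j\<in>I. (j, (h(i := b)) j) \<in> H" using h(2) b by auto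
      ultimately show ?thesis by blast
    qed
  qed
qed

text \<open>If Hall's condition failed for \<open>J\<close>, the columns of the neighbours of \<open>J\<close> together with the
  rows outside \<open>J\<close> would cover \<open>H\<close> by fewer than \<open>card M\<close> rectangles.\<close>

lemma full_boolean_rank_matching:
  fixes H :: "('a \<times> 'b) set"
  assumes "finite M" "finite (H `` M)" "H \<subseteq> M \<times> UNIV"
    and rank: "\<And>k. boolean_rank_le H k \<Longrightarrow> card M \<le> k"
  shows "\<exists>h. inj_on h M \<and> (\<forall>e\<in>M. (e, h e) \<in> H)"
proof (rule hall[OF assms(1,2)])
  fix J assume J: "J \<subseteq> M"
  \<comment> \<open>\<open>Inl a\<close> stands for the row of \<open>a\<close>, \<open>Inr b\<close> for the column of \<open>b\<close>.\<close>
  let ?C = "Inl ` (M - J) \<union> Inr ` (H `` J) :: ('a + 'b) set"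
  let ?U = "{(a, Inl a) | a. True} \<union> {(a, Inr b) | a b. (a, b) \<in> H}"
  let ?V = "{(Inl a, b) | a b. (a, b) \<in> H} \<union> {(Inr b, b) | b. True}"
  have fin: "finite (M - J)" "finite (H `` J)"
    using assms(1) finite_subset[OF _ assms(2), of "H `` J"] J by auto
  have "H \<subseteq> ?U O Id_on ?C O ?V"
  proof
    fix x assume "x \<in> H"
    moreover obtain a b where x: "x = (a, b)" by force
    ultimately have "(a, b) \<in> H" "a \<in> M" using assms(3) by auto
    then show "x \<in> ?U O Id_on ?C O ?V"
      unfolding x by (cases "a \<in> J") (auto simp: relcomp_unfold Id_on_iff image_iff)
  qed
  then have "H = ?U O Id_on ?C O ?V" by auto
  moreover have "card ?C = card (M - J) + card (H `` J)"
    using fin by (subst card_Un_disjoint) (auto simp: card_image)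
  ultimately have "card M \<le> card (M - J) + card (H `` J)"
    using rank boolean_rank_le_factor[of H ?U ?C ?V] fin by simp
  moreover have "card (M - J) = card M - card J" "card J \<le> card M"
    using J assms(1) by (auto intro: card_Diff_subset card_mono finite_subset)
  ultimately show "card J \<le> card (H `` J)" by linarith
qed

text \<open>Because of the loops, the successors of \<open>a\<close> increase with the exponent, hence stabilise; those of
  \<open>b\<close> are caught between two consecutive stages. In some power the rows of \<open>a\<close> and \<open>b\<close> thus
  coincide, and one of the two symbols can be dropped from the factorisation.\<close>

lemma boolean_rank_power_drops:
  fixes T :: "('a \<times> 'a) set"
  assumes "finite M" "T \<subseteq> M \<times> M" "a \<noteq> b" "a \<in> M"
    and ab: "(a, a) \<in> T" "(a, b) \<in> T" "(b, a) \<in> T" "(b, b) \<in> T"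
  shows "\<exists>k>0. boolean_rank_le (T ^^ k) (card M - 1)"
proof -
  define row where "row c k = (T ^^ k) `` {c}" for c k
  have sub: "row c k \<subseteq> row c' (Suc k)" if "(c', c) \<in> T" for c c' k
    using that unfolding row_def by (auto intro: relpow_Suc_I2 simp del: relpow.simps)
  have in_M: "row a (Suc k) \<subseteq> M" for k
    unfolding row_def using assms(2) by auto
  have "\<exists>k>0. row a (Suc k) = row a k"
  proof (rule ccontr)
    assume "\<not> ?thesis"
    then have strict: "row a (Suc k) \<subset> row a (Suc (Suc k))" for k
      using sub[OF ab(1), of "Suc k"] by auto
    have "k \<le> card (row a (Suc k))" for k
    proof (induction k)
      case (Suc k)
      have "card (row a (Suc k)) < card (row a (Suc (Suc k)))"
        by (rule psubset_card_mono[OF finite_subset[OF in_M assms(1)] strict])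
      with Suc show ?case by simp
    qed simp
    moreover have "card (row a (Suc k)) \<le> card M" for k
      by (rule card_mono[OF assms(1) in_M])
    ultimately have "Suc (card M) \<le> card M" by (meson le_trans)
    then show False by simp
  qed
  then obtain k where k: "k > 0" "row a (Suc k) = row a k" by blast
  \<comment> \<open>The row of \<open>b\<close> lies between two equal rows of \<open>a\<close>.\<close>
  have "row b (Suc k) = row a (Suc k)"
  proof (intro antisym)
    obtain j where j: "k = Suc j" using k(1) gr0_implies_Suc by blast
    have "row a (Suc k) = row a k" by (fact k(2))
    also have "\<dots> \<subseteq> row b (Suc k)" by (rule sub[OF ab(3)])
    finally show "row a (Suc k) \<subseteq> row b (Suc k)" .
    have "row a (Suc (Suc k)) = row a (Suc k)"
    proof -
      have "row c (Suc n) = T `` row c n" for c n unfolding row_def by (auto simp: relcomp_Image)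
      then show ?thesis using k(2) by metis
    qed
    with sub[OF ab(2), of "Suc k"] show "row b (Suc k) \<subseteq> row a (Suc k)" by simp
  qed
  then have eq: "(b, c) \<in> T ^^ Suc k \<longleftrightarrow> (a, c) \<in> T ^^ Suc k" for c
    unfolding row_def by blast
  have dom: "c \<in> M" if "(c, c') \<in> T ^^ Suc k" for c c'
    using that assms(2) by (auto dest!: relpow_Suc_D2 simp del: relpow.simps)
  let ?U = "{(c, c) | c. True} \<union> {(b, a)}"
  have bM: "b \<in> M" using ab assms(2) by auto
  have "T ^^ Suc k = ?U O Id_on (M - {b}) O T ^^ Suc k"
    using eq dom assms(3,4) by (auto simp: relcomp_unfold Id_on_iff simp del: relpow.simps)
  then have "boolean_rank_le (T ^^ Suc k) (card M - 1)"
    by (rule boolean_rank_le_factor) (use assms(1) bM in auto)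
  then show ?thesis by blast
qed

lemma finite_inj_orbit_returns:
  assumes "finite M" "inj_on s M" "s ` M \<subseteq> M" "c \<in> M"
  shows "\<exists>r>0. (s ^^ r) c = c"
proof -
  have in_M: "(s ^^ n) c \<in> M" for n
    by (induction n) (use assms in auto)
  have "\<not> inj (\<lambda>n. (s ^^ n) c)"
    using finite_subset[of "range (\<lambda>n. (s ^^ n) c)" M] in_M assms(1) finite_imageD by blast
  then obtain i j where ij: "i \<noteq> j" "(s ^^ i) c = (s ^^ j) c" by (auto simp: inj_on_def)
  have cancel: "(s ^^ r) c = c" if "(s ^^ (i + r)) c = (s ^^ i) c" for i r
    using that
  proof (induction i)
    case (Suc i)
    then show ?case using assms(2) in_M by (auto dest: inj_onD)
  qed simp
  show ?thesis
  proof (cases "i < j")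
    case True
    then show ?thesis using cancel[of i "j - i"] ij by (intro exI[of _ "j - i"]) auto
  next
    case False
    then show ?thesis using cancel[of j "i - j"] ij by (intro exI[of _ "i - j"]) auto
  qed
qed

section \<open>Labelled paths\<close>

text \<open>The label of the starting vertex is not read. With this convention concatenation of words is
  composition of relations, and repeated words give powers.\<close>

primrec label_steps :: "('a \<times> 'a) set \<Rightarrow> ('a \<Rightarrow> 'b) \<Rightarrow> 'b list \<Rightarrow> ('a \<times> 'a) set" where
  "label_steps E f [] = Id"
| "label_steps E f (b # w) = {(a, a') \<in> E. f a' = b} O label_steps E f w"

lemma label_steps_append:
  "label_steps E f (u @ v) = label_steps E f u O label_steps E f v"
  by (induction u) (auto simp: O_assoc)

lemma label_steps_iff_path:
  "(a, c) \<in> label_steps E f w \<longleftrightarrow>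
     (\<exists>u. successively (\<lambda>a b. (a, b) \<in> E) (a # u) \<and> map f u = w \<and> last (a # u) = c)"
proof (induction w arbitrary: a)
  case Nil
  then show ?case by auto
next
  case (Cons b w)
  have "(a, c) \<in> label_steps E f (b # w) \<longleftrightarrow>
    (\<exists>a'. (a, a') \<in> E \<and> f a' = b \<and> (a', c) \<in> label_steps E f w)" by auto
  also have "\<dots> \<longleftrightarrow> (\<exists>a' u. (a, a') \<in> E \<and> f a' = b \<and>
      successively (\<lambda>a b. (a, b) \<in> E) (a' # u) \<and> map f u = w \<and> last (a' # u) = c)"
    unfolding Cons.IH by blast
  also have "\<dots> \<longleftrightarrow> (\<exists>u. successively (\<lambda>a b. (a, b) \<in> E) (a # u) \<and> map f u = b # w \<and> last (a # u) = c)"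
    (is "?L \<longleftrightarrow> ?R")
  proof
    assume ?L
    then obtain a' u where "(a, a') \<in> E" "f a' = b" "successively (\<lambda>a b. (a, b) \<in> E) (a' # u)"
      "map f u = w" "last (a' # u) = c" by blast
    then show ?R by (intro exI[of _ "a' # u"]) auto
  next
    assume ?R
    then obtain u where u: "successively (\<lambda>a b. (a, b) \<in> E) (a # u)" "map f u = b # w" "last (a # u) = c"
      by (elim exE conjE)
    then obtain a' u' where "u = a' # u'" by (cases u) auto
    with u show ?L by (intro exI[of _ a'] exI[of _ u']) auto
  qed
  finally show ?case .
qed

lemma label_steps_edge:
  assumes "(a, c) \<in> label_steps E f w" "w \<noteq> []"
  shows "a \<in> Field E" "c \<in> Field E"
proof -
  show "a \<in> Field E" using assms by (cases w) (auto simp: Field_def)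
  show "c \<in> Field E" using assms
  proof (induction w arbitrary: a)
    case (Cons b w)
    then show ?case by (cases "w = []") (auto simp: Field_def)
  qed simp
qed

lemma trancl_label_steps:
  assumes "(a, c) \<in> E\<^sup>+"
  shows "\<exists>v. v \<noteq> [] \<and> (a, c) \<in> label_steps E f v"
  using assms
proof (induction rule: trancl_induct)
  case (base c)
  then show ?case by (intro exI[of _ "[f c]"]) auto
next
  case (step c c')
  then obtain v where "v \<noteq> []" "(a, c) \<in> label_steps E f v" by blast
  then show ?case using step(2)
    by (intro exI[of _ "v @ [f c']"]) (auto simp: label_steps_append)
qed

lemma length_word_at [simp]: "length (word_at x i n) = n"
  by (simp add: word_at_def)

lemma nth_word_at [simp]: "k < n \<Longrightarrow> word_at x i n ! k = x (i + int k)"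
  by (simp add: word_at_def)

lemma word_at_append: "word_at x i (m + n) = word_at x i m @ word_at x (i + int m) n"
  by (rule nth_equalityI) (auto simp: nth_append)

lemma word_at_eqI:
  assumes "\<And>j. i \<le> j \<Longrightarrow> j < i + int n \<Longrightarrow> x j = y j"
  shows "word_at x i n = word_at y i n"
  by (rule nth_equalityI) (auto intro: assms)

section \<open>Vertex shifts and the relations of end symbols\<close>

text \<open>What remains of the assumptions on the shifts and the code: a 1-step shift of finite type is the
  set of bi-infinite paths in the graph of its 2-letter words, irreducibility makes this graph strongly
  connected, and a 1-block code reads off labels of vertices.\<close>

locale vertex_code =
  fixes A :: "'a set" and X :: "(int \<Rightarrow> 'a) set" and Y :: "(int \<Rightarrow> 'b) set"
    and \<pi> :: "(int \<Rightarrow> 'a) \<Rightarrow> int \<Rightarrow> 'b" and E :: "('a \<times> 'a) set"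
  assumes finite_A: "finite A" and vertices: "Field E \<subseteq> A"
    and in_X_iff: "x \<in> X \<longleftrightarrow> (\<forall>i. (x i, x (i + 1)) \<in> E)"
    and connected: "a \<in> Field E \<Longrightarrow> c \<in> Field E \<Longrightarrow> (a, c) \<in> E\<^sup>+"
    and code: "x \<in> X \<Longrightarrow> \<pi> x i = symbol_map X \<pi> (x i)"
    and Y_eq: "Y = \<pi> ` X"
begin

abbreviation f :: "'a \<Rightarrow> 'b" where "f \<equiv> symbol_map X \<pi>"
abbreviation steps :: "'b list \<Rightarrow> ('a \<times> 'a) set" where "steps \<equiv> label_steps E f"
abbreviation is_path :: "'a list \<Rightarrow> bool" where "is_path \<equiv> successively (\<lambda>a c. (a, c) \<in> E)"

lemma finite_vertices: "finite (Field E)"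
  using finite_A vertices by (rule finite_subset[rotated])

lemma in_X_edge: "x \<in> X \<Longrightarrow> (x i, x (i + 1)) \<in> E"
  by (simp add: in_X_iff)

lemma in_X_vertex: "x \<in> X \<Longrightarrow> x i \<in> Field E"
  using in_X_edge by (auto simp: Field_def)

lemma connect:
  assumes "a \<in> Field E" "c \<in> Field E"
  shows "\<exists>v. v \<noteq> [] \<and> (a, c) \<in> steps v"
  using trancl_label_steps[OF connected[OF assms]] .

text \<open>Close the path \<open>u\<close> to a cycle and run around it forever. Besides the recurrence this shows that
  every finite path is a word of \<open>X\<close>.\<close>

lemma recurrent_point:
  assumes "is_path u" "set u \<subseteq> Field E" "u \<noteq> []"
  shows "\<exists>x\<in>X. \<forall>m. \<exists>i\<ge>m. word_at x i (length u) = u"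
proof -
  have "last u \<in> Field E" "hd u \<in> Field E" using assms by auto
  then obtain w where w: "w \<noteq> []" "(last u, hd u) \<in> steps w" using connect by blast
  then obtain v where v: "is_path (last u # v)" "last (last u # v) = hd u" "map f v = w"
    unfolding label_steps_iff_path by blast
  then have "v \<noteq> []" using w(1) by auto
  \<comment> \<open>The last vertex of \<open>v\<close> is the first one of \<open>u\<close> and must not be repeated in the cycle.\<close>
  define c where "c = u @ butlast v"
  define L where "L = int (length c)"
  have Lpos: "L > 0" using assms(3) by (cases u) (auto simp: L_def c_def)
  have v': "v = butlast v @ [hd u]"
    using v(2) \<open>v \<noteq> []\<close> by (metis append_butlast_last_id last_ConsR)
  have "is_path (u @ v)"
    using assms(1) v(1) by (cases v) (auto simp: successively_append_iff)
  then have cyc: "is_path (c @ [hd u])" unfolding c_def using v' by simp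
  have edge: "(c ! k, (c @ [hd u]) ! Suc k) \<in> E" if "k < length c" for k
    using successively_nth[OF cyc, of k] that by (simp add: nth_append)
  define x where "x i = c ! nat (i mod L)" for i
  have "(x i, x (i + 1)) \<in> E" for i
  proof -
    have b: "0 \<le> i mod L" "i mod L < L" using Lpos by auto
    have e: "(x i, (c @ [hd u]) ! Suc (nat (i mod L))) \<in> E"
      unfolding x_def by (rule edge) (use b L_def in linarith)
    show ?thesis
    proof (cases "i mod L + 1 = L")
      case True
      then have "(i + 1) mod L = 0" by (metis mod_add_left_eq mod_self)
      then have "x (i + 1) = hd u" using assms(3) by (simp add: x_def c_def hd_append hd_conv_nth[symmetric])
      moreover have "Suc (nat (i mod L)) = length c" using True b by (simp add: L_def)
      ultimately show ?thesis using e by simp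
    next
      case False
      then have "(i + 1) mod L = i mod L + 1"
        using b by (smt (verit) mod_add_left_eq mod_pos_pos_trivial)
      moreover have "nat (i mod L + 1) = Suc (nat (i mod L))" using b by simp
      moreover have "Suc (nat (i mod L)) < length c" using b False by (simp add: L_def)
      ultimately show ?thesis using e by (simp add: x_def nth_append)
    qed
  qed
  then have "x \<in> X" by (simp add: in_X_iff)
  moreover have "\<exists>i\<ge>m. word_at x i (length u) = u" for m
  proof (intro exI conjI)
    \<comment> \<open>Occurrences of \<open>u\<close> start at the multiples of the period.\<close>
    show "m \<le> \<bar>m\<bar> * L" using Lpos by (smt (verit) mult_le_cancel_left1)
    show "word_at x (\<bar>m\<bar> * L) (length u) = u"
    proof (rule nth_equalityI)
      fix k assume "k < length (word_at x (\<bar>m\<bar> * L) (length u))"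
      then have k: "k < length u" by simp
      then have "int k < L" by (simp add: L_def c_def)
      then have "(\<bar>m\<bar> * L + int k) mod L = int k" by simp
      then show "word_at x (\<bar>m\<bar> * L) (length u) ! k = u ! k"
        using k by (simp add: x_def c_def nth_append)
    qed simp
  qed
  ultimately show ?thesis by blast
qed

lemma word_at_is_path:
  assumes "x \<in> X"
  shows "is_path (word_at x i n)" "set (word_at x i n) \<subseteq> Field E"
proof -
  show "set (word_at x i n) \<subseteq> Field E" using in_X_vertex[OF assms] by (auto simp: word_at_def)
  show "is_path (word_at x i n)"
  proof (induction n)
    case (Suc n)
    have "word_at x i (Suc n) = word_at x i n @ [x (i + int n)]" by (simp add: word_at_def)
    moreover have "(x (i + int n - 1), x (i + int n)) \<in> E" using in_X_edge[OF assms, of "i + int n - 1"] by simp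
    ultimately show ?case using Suc
      by (cases n) (auto simp: successively_append_iff word_at_def algebra_simps)
  qed (simp add: word_at_def)
qed

lemma words_X_iff:
  assumes "u \<noteq> []"
  shows "u \<in> words X (length u) \<longleftrightarrow> is_path u \<and> set u \<subseteq> Field E"
proof
  assume "u \<in> words X (length u)"
  then obtain x i where "x \<in> X" "u = word_at x i (length u)" by (auto simp: words_def)
  then show "is_path u \<and> set u \<subseteq> Field E" using word_at_is_path by metis
next
  assume "is_path u \<and> set u \<subseteq> Field E"
  then show "u \<in> words X (length u)" using recurrent_point[of u] assms
    unfolding words_def by (smt (verit) mem_Collect_eq)
qed

lemma word_fibre_iff:
  assumes "w \<noteq> []"
  shows "u \<in> word_fibre X \<pi> w \<longleftrightarrow> is_path u \<and> set u \<subseteq> Field E \<and> map f u = w"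
proof -
  have "u \<in> word_fibre X \<pi> w \<longleftrightarrow> u \<in> words X (length u) \<and> map f u = w"
  proof
    assume *: "u \<in> word_fibre X \<pi> w"
    then have "length u = length w" by (auto simp: word_fibre_def word_map_def)
    with * show "u \<in> words X (length u) \<and> map f u = w"
      by (simp add: word_fibre_def word_map_def)
  next
    assume "u \<in> words X (length u) \<and> map f u = w"
    then show "u \<in> word_fibre X \<pi> w" by (auto simp: word_fibre_def word_map_def)
  qed
  moreover have "map f u = w \<Longrightarrow> u \<noteq> []" using assms by auto
  ultimately show ?thesis using words_X_iff by blast
qed

definition ends :: "'b list \<Rightarrow> ('a \<times> 'a) set" where
  "ends w = (\<lambda>u. (hd u, last u)) ` word_fibre X \<pi> w"

lemma ends_Cons: "(a, c) \<in> ends (b # v) \<longleftrightarrow> a \<in> Field E \<and> f a = b \<and> (a, c) \<in> steps v"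
proof
  assume "(a, c) \<in> ends (b # v)"
  then obtain u where u: "u \<in> word_fibre X \<pi> (b # v)" "a = hd u" "c = last u" by (auto simp: ends_def)
  then obtain u' where "u = a # u'" by (cases u) (auto simp: word_fibre_iff)
  then show "a \<in> Field E \<and> f a = b \<and> (a, c) \<in> steps v"
    using u by (auto simp: word_fibre_iff label_steps_iff_path)
next
  assume *: "a \<in> Field E \<and> f a = b \<and> (a, c) \<in> steps v"
  then obtain u where u: "is_path (a # u)" "map f u = v" "last (a # u) = c"
    by (auto simp: label_steps_iff_path)
  have "set u \<subseteq> Field E"
  proof (cases u)
    case (Cons e u')
    have "set u \<subseteq> Range E" if "is_path (a # u)" for a u
      using that by (induction u arbitrary: a) auto
    then show ?thesis using u(1) by (auto simp: Field_def)
  qed simp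
  then have "a # u \<in> word_fibre X \<pi> (b # v)"
    using u * by (subst word_fibre_iff) auto
  then show "(a, c) \<in> ends (b # v)"
    using u(3) unfolding ends_def by (intro image_eqI[of _ _ "a # u"]) auto
qed

lemma ends_Cons_eq: "ends (b # v) = Id_on {a \<in> Field E. f a = b} O steps v"
  by (auto simp: ends_Cons Id_on_iff)

lemma word_at_code: "x \<in> X \<Longrightarrow> word_at (\<pi> x) i n = map f (word_at x i n)"
  by (simp add: word_at_def code)

lemma language_Y_iff: "w \<in> language Y \<longleftrightarrow> w \<noteq> [] \<and> ends w \<noteq> {}"
proof
  assume "w \<in> language Y"
  then obtain n x i where "n \<ge> 1" "x \<in> X" "w = word_at (\<pi> x) i n"
    by (auto simp: language_def words_def Y_eq)
  moreover from this have "word_at x i n \<in> word_fibre X \<pi> w"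
    using word_at_is_path word_at_code
    by (subst word_fibre_iff) (auto simp: word_at_def)
  ultimately show "w \<noteq> [] \<and> ends w \<noteq> {}" by (auto simp: ends_def word_at_def)
next
  assume *: "w \<noteq> [] \<and> ends w \<noteq> {}"
  then obtain u where u: "u \<in> word_fibre X \<pi> w" by (auto simp: ends_def)
  from u obtain x i where x: "x \<in> X" "u = word_at x i (length w)"
    by (auto simp: word_fibre_def words_def)
  have "w = map f u" using u by (simp add: word_fibre_def word_map_def)
  then have "w = word_at (\<pi> x) i (length w)" using x word_at_code by metis
  then have "w \<in> words Y (length w)" using x(1) unfolding words_def Y_eq by blast
  moreover have "length w \<in> {1..}" using * by (cases w) auto
  ultimately show "w \<in> language Y" unfolding language_def by blast
qed

end

section \<open>Rigidity of minimal words\<close>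

lemma relpow_relpow:
  fixes R :: "('a \<times> 'a) set"
  shows "(R ^^ m) ^^ n = R ^^ (m * n)"
  by (induction n) (simp_all add: relpow_add[symmetric] add.commute)

context vertex_code
begin

text \<open>Fibre-routability of \<open>\<alpha> @ \<beta>\<close> through \<open>M\<close> at the last position of \<open>\<alpha>\<close>, expressed for
  paths that enter the word from a further vertex in front of it.\<close>

definition routes :: "'a set \<Rightarrow> 'b list \<Rightarrow> 'b list \<Rightarrow> bool" where
  "routes M \<alpha> \<beta> \<longleftrightarrow> finite M \<and> steps (\<alpha> @ \<beta>) \<subseteq> steps \<alpha> O Id_on M O steps \<beta>"

lemma routes_eq: "routes M \<alpha> \<beta> \<Longrightarrow> steps (\<alpha> @ \<beta>) = steps \<alpha> O Id_on M O steps \<beta>"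
  unfolding routes_def label_steps_append by (auto simp: Id_on_iff)

end

text \<open>The lower bound is required of all nonempty words that label a path, because it is applied below to
  words built by concatenation and repetition.\<close>

locale vertex_code_rank = vertex_code +
  fixes d :: nat
  assumes rank: "w \<noteq> [] \<Longrightarrow> steps w \<noteq> {} \<Longrightarrow> boolean_rank_le (steps w) k \<Longrightarrow> d \<le> k"
begin

text \<open>Symbols of \<open>M\<close> that are not visited can be removed from \<open>M\<close>; by the lower bound \<open>d\<close> there
  are none.\<close>

lemma routes_live:
  assumes r: "routes M \<alpha> \<beta>" and card: "card M \<le> d" and ne: "\<alpha> \<noteq> []" "steps (\<alpha> @ \<beta>) \<noteq> {}"
  shows "card M = d" "M \<subseteq> Range (steps \<alpha>)" "M \<subseteq> Domain (steps \<beta>)"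
proof -
  let ?M = "M \<inter> Range (steps \<alpha>) \<inter> Domain (steps \<beta>)"
  have fin: "finite M" using r by (simp add: routes_def)
  have "steps (\<alpha> @ \<beta>) = steps \<alpha> O Id_on ?M O steps \<beta>"
    unfolding routes_eq[OF r] by (auto simp: Id_on_iff)
  then have "boolean_rank_le (steps (\<alpha> @ \<beta>)) (card ?M)"
    by (rule boolean_rank_le_factor) (use fin in auto)
  then have "d \<le> card ?M" using rank ne by blast
  moreover have "card ?M \<le> card M" using fin by (intro card_mono) auto
  ultimately have "card ?M = card M" "card M = d" using card by auto
  then show "card M = d" "M \<subseteq> Range (steps \<alpha>)" "M \<subseteq> Domain (steps \<beta>)"
    using card_subset_eq[OF fin, of ?M] by auto
qed

text \<open>The word factors through the relation \<open>H\<close> between \<open>M1\<close> and \<open>M2\<close>, so \<open>H\<close> has rank at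
  least \<open>d\<close> and Hall's theorem applies.\<close>

lemma routes_matching:
  assumes r1: "routes M1 \<alpha>1 \<beta>1" and r2: "routes M2 \<alpha>2 \<beta>2"
    and card: "card M1 \<le> d"
    and ne: "\<alpha>1 \<noteq> []" "steps (\<alpha>1 @ \<beta>1 @ u @ \<alpha>2 @ \<beta>2) \<noteq> {}"
  shows "\<exists>h. inj_on h M1 \<and> h ` M1 \<subseteq> M2 \<and> (\<forall>e\<in>M1. (e, h e) \<in> steps (\<beta>1 @ u @ \<alpha>2))"
proof -
  define H where "H = Id_on M1 O steps (\<beta>1 @ u @ \<alpha>2) O Id_on M2"
  have eq: "steps (\<alpha>1 @ \<beta>1 @ u @ \<alpha>2 @ \<beta>2) = steps \<alpha>1 O H O steps \<beta>2"
  proof -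
    have "steps (\<alpha>1 @ \<beta>1 @ u @ \<alpha>2 @ \<beta>2) = steps (\<alpha>1 @ \<beta>1) O steps u O steps (\<alpha>2 @ \<beta>2)"
      by (simp add: label_steps_append O_assoc)
    then show ?thesis unfolding routes_eq[OF r1] routes_eq[OF r2] H_def
      by (simp add: label_steps_append O_assoc)
  qed
  have fin: "finite M1" "finite M2" using r1 r2 by (auto simp: routes_def)
  have "steps (\<alpha>1 @ \<beta>1) \<noteq> {}" using ne(2) by (auto simp: label_steps_append)
  then have "card M1 = d" using routes_live(1)[OF r1 card ne(1)] by simp
  have "\<exists>h. inj_on h M1 \<and> (\<forall>e\<in>M1. (e, h e) \<in> H)"
  proof (rule full_boolean_rank_matching)
    show "finite M1" by fact
    show "finite (H `` M1)" by (rule finite_subset[OF _ fin(2)]) (auto simp: H_def)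
    show "H \<subseteq> M1 \<times> UNIV" by (auto simp: H_def)
    fix k assume "boolean_rank_le H k"
    then have "boolean_rank_le (steps (\<alpha>1 @ \<beta>1 @ u @ \<alpha>2 @ \<beta>2)) k"
      unfolding eq by (rule boolean_rank_le_relcomp)
    then show "card M1 \<le> k" using rank ne \<open>card M1 = d\<close> by auto
  qed
  then show ?thesis unfolding H_def by auto
qed

text \<open>Going round the cycle \<open>\<alpha>1 \<beta>1 u \<alpha>2 \<beta>2 v\<close>, each passage may be assumed to visit \<open>M1\<close> and
  \<open>M2\<close>. The rank of the repeated word is therefore at most that of a power of \<open>T\<close>, a relation on
  the \<open>d\<close> symbols of \<open>M1\<close>.\<close>

lemma steps_loop:
  fixes u v
  assumes r1: "routes M1 \<alpha>1 \<beta>1" and r2: "routes M2 \<alpha>2 \<beta>2"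
  defines "T \<equiv> Id_on M1 O steps (\<beta>1 @ u @ \<alpha>2) O Id_on M2 O steps (\<beta>2 @ v @ \<alpha>1) O Id_on M1"
  shows "steps (\<alpha>1 @ concat (replicate n (\<beta>1 @ u @ \<alpha>2 @ \<beta>2 @ v @ \<alpha>1)) @ \<beta>1)
    = steps \<alpha>1 O (Id_on M1 O T ^^ n) O steps \<beta>1"
proof (induction n)
  case 0
  then show ?case using routes_eq[OF r1] by (simp add: O_assoc)
next
  case (Suc n)
  let ?C = "\<beta>1 @ u @ \<alpha>2 @ \<beta>2 @ v @ \<alpha>1"
  have I: "Id_on M1 O T ^^ n = Id_on M1 O T ^^ n O Id_on M1"
  proof (cases n)
    case 0 then show ?thesis by auto
  next
    case (Suc m)
    have "Id_on M1 O Id_on M1 = Id_on M1" by auto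
    then have "T O Id_on M1 = T" unfolding T_def by (simp add: O_assoc)
    then show ?thesis unfolding Suc by (simp add: O_assoc)
  qed
  have "replicate (Suc n) ?C = replicate n ?C @ [?C]" by (simp only: replicate_append_same replicate_Suc)
  then have "concat (replicate (Suc n) ?C) = concat (replicate n ?C) @ ?C"
    by (simp only: concat_append concat.simps append_Nil2)
  then have "steps (\<alpha>1 @ concat (replicate (Suc n) ?C) @ \<beta>1)
    = steps (\<alpha>1 @ concat (replicate n ?C) @ \<beta>1) O steps u O steps (\<alpha>2 @ \<beta>2) O steps v O steps (\<alpha>1 @ \<beta>1)"
    by (simp add: label_steps_append O_assoc)
  also have "\<dots> = steps \<alpha>1 O (Id_on M1 O T ^^ n O Id_on M1) O steps \<beta>1 O steps u O
      (steps \<alpha>2 O Id_on M2 O steps \<beta>2) O steps v O (steps \<alpha>1 O Id_on M1 O steps \<beta>1)"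
    unfolding Suc.IH routes_eq[OF r1] routes_eq[OF r2] I[symmetric] by (simp only: O_assoc)
  also have "\<dots> = steps \<alpha>1 O (Id_on M1 O T ^^ n O T) O steps \<beta>1"
    unfolding T_def[unfolded label_steps_append] by (simp only: O_assoc)
  finally show ?case by (simp add: O_assoc)
qed

text \<open>The rigidity of minimal words. Let \<open>h\<close> be a matching and suppose that \<open>e\<close> is connected also with
  \<open>e' = h c\<close>, where \<open>c \<noteq> e\<close>. Choose the return path \<open>v\<close> from \<open>e'\<close> to \<open>e\<close>. Then \<open>e\<close> and
  \<open>c\<close> both lead to \<open>e\<close> after one turn. The matchings for the way there and the way back compose to a
  permutation \<open>s\<close> of \<open>M1\<close>, and one turn leads from \<open>e\<close> to \<open>s c\<close> via \<open>e'\<close>. If \<open>s\<close>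
  returns \<open>c\<close> to itself after \<open>r\<close> turns, then \<open>r\<close> turns lead from \<open>e\<close> to \<open>c\<close>, from
  \<open>c\<close> to \<open>e\<close>, and from each to itself, so the rank of some repetition drops below \<open>d\<close>.\<close>

lemma routes_matching_unique:
  assumes r1: "routes M1 \<alpha>1 \<beta>1" and r2: "routes M2 \<alpha>2 \<beta>2"
    and card: "card M1 \<le> d" "card M2 \<le> d"
    and ne: "\<alpha>1 \<noteq> []" "\<alpha>2 \<noteq> []" "\<beta>2 \<noteq> []" "steps (\<alpha>1 @ \<beta>1 @ u @ \<alpha>2 @ \<beta>2) \<noteq> {}"
  shows "\<exists>h. bij_betw h M1 M2 \<and> (\<forall>e\<in>M1. \<forall>e'\<in>M2. (e, e') \<in> steps (\<beta>1 @ u @ \<alpha>2) \<longleftrightarrow> e' = h e)"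
proof -
  have fin: "finite M1" "finite M2" using r1 r2 by (auto simp: routes_def)
  have ne12: "steps (\<alpha>1 @ \<beta>1) \<noteq> {}" "steps (\<alpha>2 @ \<beta>2) \<noteq> {}"
    using ne(4) by (auto simp: label_steps_append)
  note live1 = routes_live[OF r1 card(1) ne(1) ne12(1)]
  note live2 = routes_live[OF r2 card(2) ne(2) ne12(2)]
  obtain h where h: "inj_on h M1" "h ` M1 \<subseteq> M2" "\<And>e. e \<in> M1 \<Longrightarrow> (e, h e) \<in> steps (\<beta>1 @ u @ \<alpha>2)"
    using routes_matching[OF r1 r2 card(1) ne(1,4)] by blast
  have im: "h ` M1 = M2"
    using card_subset_eq[OF fin(2) h(2)] live1(1) live2(1) h(1) by (simp add: card_image)
  have "e' = h e" if e: "e \<in> M1" "e' \<in> M2" "(e, e') \<in> steps (\<beta>1 @ u @ \<alpha>2)" for e e'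
  proof (rule ccontr)
    assume neq: "e' \<noteq> h e"
    obtain c where c: "c \<in> M1" "e' = h c" using im e(2) by blast
    have "c \<noteq> e" using neq c by auto
    obtain x1 where x1: "(x1, e) \<in> steps \<alpha>1" using live1(2) e(1) by blast
    obtain y1 where y1: "(e, y1) \<in> steps \<beta>1" using live1(3) e(1) by blast
    obtain x2 where x2: "(x2, e') \<in> steps \<alpha>2" using live2(2) e(2) by blast
    obtain y2 where y2: "(e', y2) \<in> steps \<beta>2" using live2(3) e(2) by blast
    have "y2 \<in> Field E" "x1 \<in> Field E"
      using label_steps_edge[OF y2 ne(3)] label_steps_edge[OF x1 ne(1)] by auto
    then obtain v where v: "(y2, x1) \<in> steps v" using connect by blast
    have return: "(e', e) \<in> steps (\<beta>2 @ v @ \<alpha>1)" using y2 v x1 by (auto simp: label_steps_append)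
    have "(x2, y1) \<in> steps (\<alpha>2 @ \<beta>2 @ v @ \<alpha>1 @ \<beta>1)"
      using x2 return y1 by (auto simp: label_steps_append)
    then obtain g where g: "inj_on g M2" "g ` M2 \<subseteq> M1" "\<And>a. a \<in> M2 \<Longrightarrow> (a, g a) \<in> steps (\<beta>2 @ v @ \<alpha>1)"
      using routes_matching[OF r2 r1 card(2) ne(2)] by (metis empty_iff)
    define s where "s = g \<circ> h"
    have s: "inj_on s M1" "s ` M1 \<subseteq> M1"
      using h(1,2) g(1,2) im by (auto simp: s_def intro: comp_inj_on)
    define T where "T = Id_on M1 O steps (\<beta>1 @ u @ \<alpha>2) O Id_on M2 O steps (\<beta>2 @ v @ \<alpha>1) O Id_on M1"
    have TI: "(a, a'') \<in> T" if "a \<in> M1" "a' \<in> M2" "a'' \<in> M1" "(a, a') \<in> steps (\<beta>1 @ u @ \<alpha>2)"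
      "(a', a'') \<in> steps (\<beta>2 @ v @ \<alpha>1)" for a a' a''
      unfolding T_def using that by (auto intro!: relcompI)
    have Ts: "(a, (s ^^ n) a) \<in> T ^^ n" if "a \<in> M1" for a n
    proof (induction n)
      case (Suc n)
      have "(s ^^ n) a \<in> M1" using that s(2) by (induction n) auto
      then have "((s ^^ n) a, (s ^^ Suc n) a) \<in> T"
        using h(2,3) g(2,3) by (intro TI[of _ "h ((s ^^ n) a)"]) (auto simp: s_def)
      with Suc show ?case by auto
    qed simp
    obtain r where r: "r > 0" "(s ^^ r) c = c"
      using finite_inj_orbit_returns[OF fin(1) s c(1)] by blast
    obtain j where j: "r = Suc j" using r(1) gr0_implies_Suc by blast
    have Tee: "(e, e) \<in> T" using e return by (intro TI) auto
    have Tce: "(c, e) \<in> T" using e(1,2) c h(3) return by (intro TI[of _ e']) auto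
    have Tesc: "(e, s c) \<in> T"
      using e c g(2,3) by (intro TI[of _ e']) (auto simp: s_def)
    have Teen: "(e, e) \<in> T ^^ n" for n
      by (induction n) (use Tee in auto)
    have "(e, c) \<in> T ^^ r"
    proof -
      have "(s c, (s ^^ j) (s c)) \<in> T ^^ j" using c(1) s(2) by (intro Ts) auto
      moreover have "(s ^^ j) (s c) = c" using r(2) j by (simp add: funpow_swap1)
      ultimately show ?thesis unfolding j using relpow_Suc_I2[OF Tesc] by metis
    qed
    moreover have "(c, e) \<in> T ^^ r" unfolding j using relpow_Suc_I2[OF Tce Teen] .
    moreover have "(c, c) \<in> T ^^ r" using Ts[OF c(1), of r] r(2) by simp
    moreover have "T ^^ r \<subseteq> M1 \<times> M1"
    proof -
      have "T \<subseteq> M1 \<times> M1" unfolding T_def by auto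
      then have "T ^^ Suc n \<subseteq> M1 \<times> M1" for n by (induction n) auto
      then show ?thesis unfolding j .
    qed
    ultimately obtain k where k: "k > 0" "boolean_rank_le ((T ^^ r) ^^ k) (card M1 - 1)"
      using boolean_rank_power_drops[OF fin(1), of "T ^^ r" e c] \<open>c \<noteq> e\<close> e(1) Teen by blast
    let ?w = "\<alpha>1 @ concat (replicate (r * k) (\<beta>1 @ u @ \<alpha>2 @ \<beta>2 @ v @ \<alpha>1)) @ \<beta>1"
    have eq: "steps ?w = (steps \<alpha>1 O Id_on M1) O (T ^^ r) ^^ k O steps \<beta>1"
      using steps_loop[OF r1 r2, of "r * k" u v, folded T_def] by (simp add: O_assoc relpow_relpow)
    have "(x1, y1) \<in> steps ?w"
      unfolding eq using x1 y1 e(1) Teen[of "r * k"] by (auto simp: relpow_relpow intro!: relcompI)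
    moreover have "boolean_rank_le (steps ?w) (card M1 - 1)"
      unfolding eq using k(2) by (rule boolean_rank_le_relcomp)
    ultimately have "d \<le> d - 1" using rank[of ?w] ne(1) live1(1) by auto
    moreover have "d > 0" using e(1) fin(1) live1(1) card_gt_0_iff by blast
    ultimately show False by simp
  qed
  moreover have "bij_betw h M1 M2" using h(1) im by (simp add: bij_betw_def)
  ultimately show ?thesis using h(3) by blast
qed

text \<open>The form in which depth at most \<open>d\<close> is used for \<open>steps\<close>.\<close>

definition narrow :: "'b list \<Rightarrow> bool" where
  "narrow w \<longleftrightarrow> (\<exists>M \<alpha> \<beta>. w = \<alpha> @ \<beta> \<and> \<alpha> \<noteq> [] \<and> \<beta> \<noteq> [] \<and> routes M \<alpha> \<beta> \<and> card M \<le> d)"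

lemma narrow_pair:
  assumes "narrow w1" "narrow w2" "steps (w1 @ u @ w2) \<noteq> {}"
  obtains h M1 M2 \<alpha>1 \<beta>1 \<alpha>2 \<beta>2 where
    "w1 = \<alpha>1 @ \<beta>1" "w2 = \<alpha>2 @ \<beta>2" "bij_betw h M1 M2"
    "steps w1 = steps \<alpha>1 O Id_on M1 O steps \<beta>1" "steps w2 = steps \<alpha>2 O Id_on M2 O steps \<beta>2"
    "\<And>e e'. e \<in> M1 \<Longrightarrow> e' \<in> M2 \<Longrightarrow> (e, e') \<in> steps (\<beta>1 @ u @ \<alpha>2) \<longleftrightarrow> e' = h e"
    "M1 \<subseteq> Range (steps \<alpha>1)" "M2 \<subseteq> Domain (steps \<beta>2)"
proof -
  obtain M1 \<alpha>1 \<beta>1 where 1: "w1 = \<alpha>1 @ \<beta>1" "\<alpha>1 \<noteq> []" "routes M1 \<alpha>1 \<beta>1" "card M1 \<le> d"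
    using assms(1) unfolding narrow_def by blast
  obtain M2 \<alpha>2 \<beta>2 where 2: "w2 = \<alpha>2 @ \<beta>2" "\<alpha>2 \<noteq> []" "\<beta>2 \<noteq> []" "routes M2 \<alpha>2 \<beta>2" "card M2 \<le> d"
    using assms(2) unfolding narrow_def by blast
  have "steps w1 \<noteq> {}" "steps w2 \<noteq> {}" using assms(3) by (auto simp: label_steps_append)
  moreover obtain h where "bij_betw h M1 M2"
      "\<forall>e\<in>M1. \<forall>e'\<in>M2. (e, e') \<in> steps (\<beta>1 @ u @ \<alpha>2) \<longleftrightarrow> e' = h e"
    using routes_matching_unique[OF 1(3) 2(4) 1(4) 2(5) 1(2) 2(2,3), of u] assms(3) 1(1) 2(1)
    by (metis append_assoc)
  moreover have "steps w1 = steps \<alpha>1 O Id_on M1 O steps \<beta>1" "steps w2 = steps \<alpha>2 O Id_on M2 O steps \<beta>2"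
    unfolding 1(1) 2(1) by (fact routes_eq[OF 1(3)], fact routes_eq[OF 2(4)])
  ultimately show ?thesis
    using that[OF 1(1) 2(1), of h M1 M2] routes_live(2)[OF 1(3,4,2)] routes_live(3)[OF 2(4,5,2)]
      1(1) 2(1) by metis
qed

text \<open>Starting at \<open>c\<close>, both paths come from the same symbol of \<open>M1\<close>, hence they can be routed through
  the same symbol of \<open>M2\<close> only, and there they can be exchanged.\<close>

lemma merge_right:
  assumes "narrow w1" "narrow w2"
    and "(a, c) \<in> steps w1" "(c, x) \<in> steps u" "(c, x') \<in> steps u"
    and "(x, y) \<in> steps w2" "(x', y') \<in> steps w2"
  shows "(x, y') \<in> steps w2"
proof -
  have "(a, y) \<in> steps (w1 @ u @ w2)" using assms by (auto simp: label_steps_append)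
  then have "steps (w1 @ u @ w2) \<noteq> {}" by blast
  from narrow_pair[OF assms(1,2) this] obtain h M1 M2 \<alpha>1 \<beta>1 \<alpha>2 \<beta>2 where
    *: "w1 = \<alpha>1 @ \<beta>1" "w2 = \<alpha>2 @ \<beta>2" "bij_betw h M1 M2"
    "steps w1 = steps \<alpha>1 O Id_on M1 O steps \<beta>1" "steps w2 = steps \<alpha>2 O Id_on M2 O steps \<beta>2"
    "\<And>e e'. e \<in> M1 \<Longrightarrow> e' \<in> M2 \<Longrightarrow> (e, e') \<in> steps (\<beta>1 @ u @ \<alpha>2) \<longleftrightarrow> e' = h e" by metis
  obtain e where e: "e \<in> M1" "(e, c) \<in> steps \<beta>1" using assms(3) *(4) by auto
  obtain p where p: "p \<in> M2" "(x, p) \<in> steps \<alpha>2" using assms(6) *(5) by auto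
  obtain p' where p': "p' \<in> M2" "(x', p') \<in> steps \<alpha>2" "(p', y') \<in> steps \<beta>2" using assms(7) *(5) by auto
  have "(e, p) \<in> steps (\<beta>1 @ u @ \<alpha>2)" "(e, p') \<in> steps (\<beta>1 @ u @ \<alpha>2)"
    using e p p' assms(4,5) by (auto simp: label_steps_append)
  then have "p = p'" using *(6) e(1) p(1) p'(1) by metis
  then show ?thesis using p p' *(5) by auto
qed

text \<open>The mirror image of \<open>merge_right\<close>: the common symbol \<open>x\<close> fixes the symbol of \<open>M2\<close>, and the
  matching is injective.\<close>

lemma merge_left:
  assumes "narrow w1" "narrow w2"
    and "(a, c) \<in> steps w1" "(a', c') \<in> steps w1" "(c, x) \<in> steps u" "(c', x) \<in> steps u"
    and "(x, y) \<in> steps w2"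
  shows "(a, c') \<in> steps w1"
proof -
  have "(a, y) \<in> steps (w1 @ u @ w2)" using assms by (auto simp: label_steps_append)
  then have "steps (w1 @ u @ w2) \<noteq> {}" by blast
  from narrow_pair[OF assms(1,2) this] obtain h M1 M2 \<alpha>1 \<beta>1 \<alpha>2 \<beta>2 where
    *: "w1 = \<alpha>1 @ \<beta>1" "w2 = \<alpha>2 @ \<beta>2" "bij_betw h M1 M2"
    "steps w1 = steps \<alpha>1 O Id_on M1 O steps \<beta>1" "steps w2 = steps \<alpha>2 O Id_on M2 O steps \<beta>2"
    "\<And>e e'. e \<in> M1 \<Longrightarrow> e' \<in> M2 \<Longrightarrow> (e, e') \<in> steps (\<beta>1 @ u @ \<alpha>2) \<longleftrightarrow> e' = h e" by metis
  obtain e where e: "e \<in> M1" "(a, e) \<in> steps \<alpha>1" "(e, c) \<in> steps \<beta>1" using assms(3) *(4) by auto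
  obtain e' where e': "e' \<in> M1" "(e', c') \<in> steps \<beta>1" using assms(4) *(4) by auto
  obtain p where p: "p \<in> M2" "(x, p) \<in> steps \<alpha>2" using assms(7) *(5) by auto
  have "(e, p) \<in> steps (\<beta>1 @ u @ \<alpha>2)" "(e', p) \<in> steps (\<beta>1 @ u @ \<alpha>2)"
    using e p e' assms(5,6) by (auto simp: label_steps_append)
  then have "h e = h e'" using *(6) e(1) p(1) e'(1) by metis
  then have "e = e'" using *(3) e(1) e'(1) by (auto simp: bij_betw_def dest: inj_onD)
  then show ?thesis using e e' *(4) by auto
qed

text \<open>A path over \<open>w1\<close> can be routed through \<open>M1\<close>, and from there the matching leads on to \<open>M2\<close>
  and across \<open>w2\<close>.\<close>

lemma Domain_steps_extend:
  assumes "narrow w1" "narrow w2" "steps (w1 @ u @ w2) \<noteq> {}"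
  shows "Domain (steps w1) \<subseteq> Domain (steps (w1 @ u @ w2))"
proof
  fix a assume "a \<in> Domain (steps w1)"
  then obtain c where ac: "(a, c) \<in> steps w1" by blast
  from narrow_pair[OF assms] obtain h M1 M2 \<alpha>1 \<beta>1 \<alpha>2 \<beta>2 where
    *: "w1 = \<alpha>1 @ \<beta>1" "w2 = \<alpha>2 @ \<beta>2" "bij_betw h M1 M2"
    "steps w1 = steps \<alpha>1 O Id_on M1 O steps \<beta>1"
    "\<And>e e'. e \<in> M1 \<Longrightarrow> e' \<in> M2 \<Longrightarrow> (e, e') \<in> steps (\<beta>1 @ u @ \<alpha>2) \<longleftrightarrow> e' = h e"
    "M2 \<subseteq> Domain (steps \<beta>2)" by metis
  obtain e where e: "e \<in> M1" "(a, e) \<in> steps \<alpha>1" using ac *(4) by auto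
  have he: "h e \<in> M2" using *(3) e(1) by (auto simp: bij_betw_def)
  then obtain y where "(h e, y) \<in> steps \<beta>2" using *(6) by blast
  moreover have "(e, h e) \<in> steps (\<beta>1 @ u @ \<alpha>2)" using *(5) e(1) he by metis
  ultimately have "(a, y) \<in> steps (w1 @ u @ w2)"
    unfolding *(1,2) using e(2) by (auto simp: label_steps_append)
  then show "a \<in> Domain (steps (w1 @ u @ w2))" by blast
qed

lemma Range_steps_extend:
  assumes "narrow w1" "narrow w2" "steps (w1 @ u @ w2) \<noteq> {}"
  shows "Range (steps w2) \<subseteq> Range (steps (w1 @ u @ w2))"
proof
  fix y assume "y \<in> Range (steps w2)"
  then obtain x where xy: "(x, y) \<in> steps w2" by blast
  from narrow_pair[OF assms] obtain h M1 M2 \<alpha>1 \<beta>1 \<alpha>2 \<beta>2 where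
    *: "w1 = \<alpha>1 @ \<beta>1" "w2 = \<alpha>2 @ \<beta>2" "bij_betw h M1 M2"
    "steps w2 = steps \<alpha>2 O Id_on M2 O steps \<beta>2"
    "\<And>e e'. e \<in> M1 \<Longrightarrow> e' \<in> M2 \<Longrightarrow> (e, e') \<in> steps (\<beta>1 @ u @ \<alpha>2) \<longleftrightarrow> e' = h e"
    "M1 \<subseteq> Range (steps \<alpha>1)" by metis
  obtain p where p: "p \<in> M2" "(p, y) \<in> steps \<beta>2" using xy *(4) by auto
  then obtain e where e: "e \<in> M1" "p = h e" using *(3) by (auto simp: bij_betw_def)
  then obtain a where "(a, e) \<in> steps \<alpha>1" using *(6) by blast
  moreover have "(e, p) \<in> steps (\<beta>1 @ u @ \<alpha>2)" using *(5) e p(1) by metis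
  ultimately have "(a, y) \<in> steps (w1 @ u @ w2)"
    unfolding *(1,2) using p(2) by (auto simp: label_steps_append)
  then show "y \<in> Range (steps (w1 @ u @ w2))" by blast
qed

end

section \<open>Points over a window and compactness\<close>

text \<open>Sequential compactness of the full shift. Passing to smaller and smaller infinite sets of indices,
  the sequence becomes constant on larger and larger windows.\<close>

lemma window_limit:
  fixes s :: "nat \<Rightarrow> int \<Rightarrow> 'a"
  assumes "finite S" "\<And>n i. s n i \<in> S"
  shows "\<exists>z. \<forall>k::nat. \<exists>n\<ge>k. \<forall>i. \<bar>i\<bar> \<le> int k \<longrightarrow> z i = s n i"
proof -
  have "\<exists>N. \<forall>k. (infinite (N k) \<and> (\<forall>n\<in>N k. \<forall>n'\<in>N k. \<forall>i. \<bar>i\<bar> < int k \<longrightarrow> s n i = s n' i)) \<and> N (Suc k) \<subseteq> N k"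
  proof (rule dependent_nat_choice)
    show "\<exists>N. infinite N \<and> (\<forall>n\<in>N. \<forall>n'\<in>N. \<forall>i. \<bar>i\<bar> < int 0 \<longrightarrow> s n i = s n' i)"
      by (intro exI[of _ UNIV]) auto
  next
    fix N :: "nat set" and k :: nat
    assume N: "infinite N \<and> (\<forall>n\<in>N. \<forall>n'\<in>N. \<forall>i. \<bar>i\<bar> < int k \<longrightarrow> s n i = s n' i)"
    let ?r = "\<lambda>n. restrict (s n) {- int k..int k}"
    have "?r ` N \<subseteq> {- int k..int k} \<rightarrow>\<^sub>E S" using assms(2) by auto
    then have "finite (?r ` N)" by (rule finite_subset) (auto intro: finite_PiE assms(1))
    from pigeonhole_infinite[OF _ this] N obtain n0 where n0: "n0 \<in> N" "infinite {n \<in> N. ?r n = ?r n0}"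
      by blast
    have "s n i = s n' i" if "?r n = ?r n0" "?r n' = ?r n0" "\<bar>i\<bar> < int (Suc k)" for n n' i
    proof -
      have "i \<in> {- int k..int k}" using that(3) by auto
      then show ?thesis using fun_cong[OF that(1), of i] fun_cong[OF that(2), of i] by simp
    qed
    then have "\<forall>n\<in>{n \<in> N. ?r n = ?r n0}. \<forall>n'\<in>{n \<in> N. ?r n = ?r n0}.
      \<forall>i. \<bar>i\<bar> < int (Suc k) \<longrightarrow> s n i = s n' i" by blast
    moreover have "{n \<in> N. ?r n = ?r n0} \<subseteq> N" by blast
    ultimately show "\<exists>N'. (infinite N' \<and> (\<forall>n\<in>N'. \<forall>n'\<in>N'. \<forall>i. \<bar>i\<bar> < int (Suc k) \<longrightarrow> s n i = s n' i)) \<and> N' \<subseteq> N"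
      using n0(2) by (intro exI[of _ "{n \<in> N. ?r n = ?r n0}"] conjI)
  qed
  then obtain N where N0: "\<forall>k. (infinite (N k) \<and>
      (\<forall>n\<in>N k. \<forall>n'\<in>N k. \<forall>i. \<bar>i\<bar> < int k \<longrightarrow> s n i = s n' i)) \<and> N (Suc k) \<subseteq> N k"
    by (elim exE)
  have N: "infinite (N k)" "N (Suc k) \<subseteq> N k"
    "n \<in> N k \<Longrightarrow> n' \<in> N k \<Longrightarrow> \<bar>i\<bar> < int k \<Longrightarrow> s n i = s n' i" for k n n' i
    by (fact N0[THEN spec, THEN conjunct1, THEN conjunct1], fact N0[THEN spec, THEN conjunct2],
        use N0[THEN spec, of k, THEN conjunct1, THEN conjunct2] in blast)
  have "\<exists>n\<ge>k. n \<in> N (Suc k)" for k using N(1) by (meson infinite_nat_iff_unbounded_le)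
  then obtain t where t: "\<And>k. t k \<ge> k" "\<And>k. t k \<in> N (Suc k)" by metis
  have anti: "N k' \<subseteq> N k" if "k \<le> k'" for k k' using that N(2) by (rule lift_Suc_antimono_le[rotated])
  have "s (t (nat \<bar>i\<bar>)) i = s (t k) i" if "\<bar>i\<bar> \<le> int k" for i k
  proof (rule N(3))
    show "t (nat \<bar>i\<bar>) \<in> N (Suc (nat \<bar>i\<bar>))" by (rule t)
    have "Suc (nat \<bar>i\<bar>) \<le> Suc k" using that by simp
    then show "t k \<in> N (Suc (nat \<bar>i\<bar>))" using t(2)[of k] anti by blast
    show "\<bar>i\<bar> < int (Suc (nat \<bar>i\<bar>))" by simp
  qed
  then show ?thesis using t(1) by (intro exI[of _ "\<lambda>i. s (t (nat \<bar>i\<bar>)) i"]) blast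
qed

context vertex_code
begin

lemma limit_point:
  assumes "\<And>n i. s n i \<in> Field E"
    and edge: "\<And>n i. - int n \<le> i \<Longrightarrow> i < int n \<Longrightarrow> (s n i, s n (i + 1)) \<in> E"
  shows "\<exists>x\<in>X. \<forall>k::nat. \<exists>n\<ge>k. \<forall>i. \<bar>i\<bar> \<le> int k \<longrightarrow> x i = s n i"
proof -
  obtain x where x: "\<And>k::nat. \<exists>n\<ge>k. \<forall>i. \<bar>i\<bar> \<le> int k \<longrightarrow> x i = s n i"
    using window_limit[of "Field E" s] finite_vertices assms(1) by metis
  have "(x i, x (i + 1)) \<in> E" for i
  proof -
    obtain n where n: "n \<ge> nat (\<bar>i\<bar> + 1)" "\<And>j. \<bar>j\<bar> \<le> int (nat (\<bar>i\<bar> + 1)) \<Longrightarrow> x j = s n j"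
      using x by meson
    then have "x i = s n i" "x (i + 1) = s n (i + 1)" by auto
    moreover have "(s n i, s n (i + 1)) \<in> E" using n(1) by (intro edge) auto
    ultimately show ?thesis by simp
  qed
  then have "x \<in> X" by (simp add: in_X_iff)
  with x show ?thesis by blast
qed

text \<open>Positions \<open>m\<close> and \<open>n\<close> are those of the two end vertices; the labels read are those of \<open>y\<close> on
  \<open>{m<..n}\<close>, so that \<open>reach y m n O reach y n p = reach y m p\<close>.\<close>

definition reach :: "(int \<Rightarrow> 'b) \<Rightarrow> int \<Rightarrow> int \<Rightarrow> ('a \<times> 'a) set" where
  "reach y m n = steps (word_at y (m + 1) (nat (n - m)))"

lemma reach_refl [simp]: "reach y m m = Id"
  by (simp add: reach_def word_at_def)

lemma reach_comp:
  assumes "m \<le> n" "n \<le> p"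
  shows "reach y m n O reach y n p = reach y m p"
proof -
  have "nat (p - m) = nat (n - m) + nat (p - n)" using assms by simp
  moreover have "m + 1 + int (nat (n - m)) = n + 1" using assms by simp
  ultimately show ?thesis
    unfolding reach_def by (simp only: word_at_append label_steps_append)
qed

lemma reach_trans:
  assumes "(a, c) \<in> reach y m n" "(c, e) \<in> reach y n p" "m \<le> n" "n \<le> p"
  shows "(a, e) \<in> reach y m p"
  using assms reach_comp by blast

lemma reach_Suc:
  assumes "m \<le> n"
  shows "reach y m (n + 1) = reach y m n O {(a, c) \<in> E. f c = y (n + 1)}"
proof -
  have "reach y n (n + 1) = {(a, c) \<in> E. f c = y (n + 1)}" by (auto simp: reach_def word_at_def)
  then show ?thesis using reach_comp[of m n "n + 1" y] assms by simp
qed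

lemma reach_path:
  assumes "m \<le> n" "\<And>i. m \<le> i \<Longrightarrow> i < n \<Longrightarrow> (z i, z (i + 1)) \<in> E"
    "\<And>i. m < i \<Longrightarrow> i \<le> n \<Longrightarrow> f (z i) = y i"
  shows "(z m, z n) \<in> reach y m n"
  using assms
proof (induction n rule: int_ge_induct)
  case (step n)
  then have "(z m, z n) \<in> reach y m n" by simp
  then show ?case using step by (auto simp: reach_Suc)
qed simp

lemma path_of_reach:
  assumes "m \<le> n" "(a, c) \<in> reach y m n"
  shows "\<exists>z. z m = a \<and> z n = c \<and> (\<forall>i. m \<le> i \<and> i < n \<longrightarrow> (z i, z (i + 1)) \<in> E) \<and>
    (\<forall>i. m < i \<and> i \<le> n \<longrightarrow> f (z i) = y i)"
  using assms
proof (induction n arbitrary: c rule: int_ge_induct)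
  case base
  then show ?case by (intro exI[of _ "\<lambda>_. a"]) auto
next
  case (step n)
  then obtain e where e: "(a, e) \<in> reach y m n" "(e, c) \<in> E" "f c = y (n + 1)"
    by (auto simp: reach_Suc)
  then obtain z where z: "z m = a" "z n = e" "\<And>i. m \<le> i \<Longrightarrow> i < n \<Longrightarrow> (z i, z (i + 1)) \<in> E"
    "\<And>i. m < i \<Longrightarrow> i \<le> n \<Longrightarrow> f (z i) = y i" using step by blast
  have "((z(n + 1 := c)) i, (z(n + 1 := c)) (i + 1)) \<in> E" if "m \<le> i" "i < n + 1" for i
    using that z e by (cases "i = n") auto
  moreover have "f ((z(n + 1 := c)) i) = y i" if "m < i" "i \<le> n + 1" for i
    using that z e by (cases "i = n + 1") auto
  ultimately show ?case using z(1) step(1) by (intro exI[of _ "z(n + 1 := c)"]) auto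
qed

lemma reach_point:
  assumes "x \<in> X" "m \<le> n" "\<And>i. m < i \<Longrightarrow> i \<le> n \<Longrightarrow> \<pi> x i = y i"
  shows "(x m, x n) \<in> reach y m n"
  using assms in_X_edge code by (intro reach_path) auto

lemma in_fibre_iff: "x \<in> fibre X \<pi> y \<longleftrightarrow> x \<in> X \<and> (\<forall>i. f (x i) = y i)"
  unfolding fibre_def using code by (auto simp: fun_eq_iff)

lemma reach_fibre: "x \<in> fibre X \<pi> y \<Longrightarrow> m \<le> n \<Longrightarrow> (x m, x n) \<in> reach y m n"
  using reach_point[of x m n y] by (simp add: fibre_def)

lemma splice:
  assumes "x \<in> X" "x' \<in> X" "m \<le> n" "(x m, x' n) \<in> reach y m n"
  obtains z where "z \<in> X" "\<And>i. i \<le> m \<Longrightarrow> z i = x i" "\<And>i. i \<ge> n \<Longrightarrow> z i = x' i"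
    "\<And>i. m < i \<Longrightarrow> i \<le> n \<Longrightarrow> f (z i) = y i"
proof -
  obtain p where p: "p m = x m" "p n = x' n" "\<And>i. m \<le> i \<Longrightarrow> i < n \<Longrightarrow> (p i, p (i + 1)) \<in> E"
    "\<And>i. m < i \<Longrightarrow> i \<le> n \<Longrightarrow> f (p i) = y i" using path_of_reach[OF assms(3,4)] by blast
  define z where "z i = (if i \<le> m then x i else if i \<ge> n then x' i else p i)" for i
  have zp: "z i = p i" if "m \<le> i" "i \<le> n" for i
    using that p by (auto simp: z_def)
  have zx: "z i = x' i" if "i \<ge> n" for i
    using that p assms(3) by (cases "i = n") (auto simp: z_def)
  have "(z i, z (i + 1)) \<in> E" for i
  proof -
    consider "i < m" | "m \<le> i" "i < n" | "i \<ge> n" by linarith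
    then show ?thesis
    proof cases
      case 1 then show ?thesis using in_X_edge[OF assms(1)] by (simp add: z_def)
    next
      case 2 then show ?thesis using zp[of i] zp[of "i + 1"] p(3) by simp
    next
      case 3 then show ?thesis using zx[of i] zx[of "i + 1"] in_X_edge[OF assms(2)] by simp
    qed
  qed
  then have "z \<in> X" by (simp add: in_X_iff)
  then show ?thesis
  proof (rule that)
    show "z i = x i" if "i \<le> m" for i using that by (simp add: z_def)
    show "z i = x' i" if "i \<ge> n" for i using that by (rule zx)
    show "f (z i) = y i" if "m < i" "i \<le> n" for i using that zp[of i] p(4) by simp
  qed
qed

lemma splice_fibre:
  assumes "x \<in> fibre X \<pi> y" "x' \<in> fibre X \<pi> y" "m \<le> n" "(x m, x' n) \<in> reach y m n"
  obtains z where "z \<in> fibre X \<pi> y" "\<And>i. i \<le> m \<Longrightarrow> z i = x i" "\<And>i. i \<ge> n \<Longrightarrow> z i = x' i"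
proof -
  obtain z where z: "z \<in> X" "\<And>i. i \<le> m \<Longrightarrow> z i = x i" "\<And>i. i \<ge> n \<Longrightarrow> z i = x' i"
    "\<And>i. m < i \<Longrightarrow> i \<le> n \<Longrightarrow> f (z i) = y i"
    using splice[of x x' m n y] assms by (metis in_fibre_iff)
  have "f (z i) = y i" for i
    using z(2-4)[of i] assms(1,2) by (cases "i \<le> m"; cases "i \<le> n") (simp_all add: in_fibre_iff)
  then show ?thesis using that[of z] z by (simp add: in_fibre_iff)
qed

text \<open>By splicing, a bridge needs to be known only through its end symbols.\<close>

lemma right_reach_iff:
  assumes "x \<in> fibre X \<pi> y" "x' \<in> fibre X \<pi> y"
  shows "right_reach X \<pi> x x' \<longleftrightarrow> (\<forall>m. \<exists>n>m. (x m, x' n) \<in> reach y m n)"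
proof -
  have \<pi>x: "\<pi> x = y" using assms(1) by (simp add: fibre_def)
  have "(\<exists>z. right_bridge X \<pi> m x x' z) \<longleftrightarrow> (\<exists>n>m. (x m, x' n) \<in> reach y m n)" for m
  proof
    assume "\<exists>z. right_bridge X \<pi> m x x' z"
    then obtain z n where "z \<in> fibre X \<pi> y" "n > m" "z m = x m" "z n = x' n"
      by (auto simp: right_bridge_def fibre_def \<pi>x)
    then show "\<exists>n>m. (x m, x' n) \<in> reach y m n" using reach_fibre[of z y m n] by auto
  next
    assume "\<exists>n>m. (x m, x' n) \<in> reach y m n"
    then obtain n where n: "n > m" "(x m, x' n) \<in> reach y m n" by blast
    then obtain z where "z \<in> fibre X \<pi> y" "\<And>i. i \<le> m \<Longrightarrow> z i = x i" "\<And>i. i \<ge> n \<Longrightarrow> z i = x' i"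
      using splice_fibre[OF assms, of m n] by auto
    then show "\<exists>z. right_bridge X \<pi> m x x' z"
      using n(1) by (auto simp: right_bridge_def fibre_def \<pi>x)
  qed
  then show ?thesis by (simp add: right_reach_def)
qed

lemma left_reach_iff:
  assumes "x \<in> fibre X \<pi> y" "x' \<in> fibre X \<pi> y"
  shows "left_reach X \<pi> x x' \<longleftrightarrow> (\<forall>m. \<exists>n<m. (x' n, x m) \<in> reach y n m)"
proof -
  have \<pi>x: "\<pi> x = y" using assms(1) by (simp add: fibre_def)
  have "(\<exists>z. left_bridge X \<pi> m x x' z) \<longleftrightarrow> (\<exists>n<m. (x' n, x m) \<in> reach y n m)" for m
  proof
    assume "\<exists>z. left_bridge X \<pi> m x x' z"
    then obtain z n where "z \<in> fibre X \<pi> y" "n < m" "z m = x m" "z n = x' n"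
      by (auto simp: left_bridge_def fibre_def \<pi>x)
    then show "\<exists>n<m. (x' n, x m) \<in> reach y n m" using reach_fibre[of z y n m] by auto
  next
    assume "\<exists>n<m. (x' n, x m) \<in> reach y n m"
    then obtain n where n: "n < m" "(x' n, x m) \<in> reach y n m" by blast
    then obtain z where "z \<in> fibre X \<pi> y" "\<And>i. i \<le> n \<Longrightarrow> z i = x' i" "\<And>i. i \<ge> m \<Longrightarrow> z i = x i"
      using splice_fibre[OF assms(2,1), of n m] by auto
    then show "\<exists>z. left_bridge X \<pi> m x x' z"
      using n(1) by (auto simp: left_bridge_def fibre_def \<pi>x)
  qed
  then show ?thesis by (simp add: left_reach_def)
qed

lemma right_reach_refl: "x \<in> fibre X \<pi> y \<Longrightarrow> right_reach X \<pi> x x"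
  using reach_fibre[of x y] by (subst right_reach_iff) (auto intro: exI[of _ "_ + 1"])

lemma right_reach_trans:
  assumes "x \<in> fibre X \<pi> y" "x' \<in> fibre X \<pi> y" "x'' \<in> fibre X \<pi> y"
    "right_reach X \<pi> x x'" "right_reach X \<pi> x' x''"
  shows "right_reach X \<pi> x x''"
  unfolding right_reach_iff[OF assms(1,3)]
proof
  fix m
  obtain n where n: "n > m" "(x m, x' n) \<in> reach y m n" using assms by (auto simp: right_reach_iff)
  obtain p where p: "p > n" "(x' n, x'' p) \<in> reach y n p" using assms by (auto simp: right_reach_iff)
  show "\<exists>n>m. (x m, x'' n) \<in> reach y m n"
    using n p reach_trans[of "x m" "x' n" y m n "x'' p" p] by (intro exI[of _ p]) auto
qed

lemma right_equivalent_iff: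
  assumes "x \<in> fibre X \<pi> y"
  shows "right_equivalent X \<pi> x x' \<longleftrightarrow> x' \<in> fibre X \<pi> y \<and> right_reach X \<pi> x x' \<and> right_reach X \<pi> x' x"
  using assms by (auto simp: right_equivalent_def fibre_def)

section \<open>Counting right classes\<close>

lemma num_right_classes_le_representatives:
  assumes "num_right_classes X \<pi> y \<le> enat k"
  obtains Z where "Z \<subseteq> fibre X \<pi> y" "finite Z" "card Z \<le> k"
    "\<And>x. x \<in> fibre X \<pi> y \<Longrightarrow> \<exists>z\<in>Z. right_equivalent X \<pi> z x"
proof -
  let ?r = "{(x, x'). right_equivalent X \<pi> x x'}"
  let ?Q = "fibre X \<pi> y // ?r"
  have fin: "finite ?Q" "card ?Q \<le> k"
    using assms by (auto simp: num_right_classes_def ecard_def split: if_splits)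
  have "\<forall>C\<in>?Q. \<exists>z\<in>fibre X \<pi> y. C = ?r `` {z}" by (auto simp: quotient_def)
  then obtain g where g: "\<And>C. C \<in> ?Q \<Longrightarrow> g C \<in> fibre X \<pi> y \<and> C = ?r `` {g C}" by metis
  show ?thesis
  proof (rule that[of "g ` ?Q"])
    show "g ` ?Q \<subseteq> fibre X \<pi> y" using g by blast
    show "finite (g ` ?Q)" "card (g ` ?Q) \<le> k" using fin card_image_le[of ?Q g] by auto
    fix x assume x: "x \<in> fibre X \<pi> y"
    then have "right_equivalent X \<pi> x x" using right_reach_refl by (simp add: right_equivalent_iff)
    moreover have C: "?r `` {x} \<in> ?Q" using x by (rule quotientI)
    moreover have "?r `` {x} = ?r `` {g (?r `` {x})}" using g[OF C] by (rule conjunct2)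
    ultimately have "x \<in> ?r `` {g (?r `` {x})}" by (metis (no_types) Image_singleton_iff case_prodI mem_Collect_eq)
    then have "right_equivalent X \<pi> (g (?r `` {x})) x" by (simp only: Image_singleton_iff mem_Collect_eq case_prod_conv)
    then show "\<exists>z\<in>g ` ?Q. right_equivalent X \<pi> z x" using C by (intro bexI[OF _ imageI])
  qed
qed

text \<open>One representative from each of \<open>k + 1\<close> classes would contradict the assumption, as equivalent
  points span the same class.\<close>

lemma num_right_classes_leI:
  assumes "\<And>F. finite F \<Longrightarrow> F \<subseteq> fibre X \<pi> y \<Longrightarrow> card F = Suc k \<Longrightarrow>
    \<exists>x\<in>F. \<exists>x'\<in>F. x \<noteq> x' \<and> right_equivalent X \<pi> x x'"
  shows "num_right_classes X \<pi> y \<le> enat k"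
proof (rule ccontr)
  let ?r = "{(x, x'). right_equivalent X \<pi> x x'}"
  let ?Q = "fibre X \<pi> y // ?r"
  assume "\<not> ?thesis"
  then have "infinite ?Q \<or> Suc k \<le> card ?Q"
    by (auto simp: num_right_classes_def ecard_def split: if_splits)
  then obtain Q where Q: "finite Q" "card Q = Suc k" "Q \<subseteq> ?Q"
    by (metis infinite_arbitrarily_large obtain_subset_with_card_n)
  then have "\<forall>C\<in>Q. \<exists>z\<in>fibre X \<pi> y. C = ?r `` {z}" by (auto simp: quotient_def)
  then obtain g where g: "\<And>C. C \<in> Q \<Longrightarrow> g C \<in> fibre X \<pi> y" "\<And>C. C \<in> Q \<Longrightarrow> C = ?r `` {g C}" by metis
  have inj: "inj_on g Q" using g(2) by (metis inj_onI)
  obtain C C' where C: "C \<in> Q" "C' \<in> Q" "g C \<noteq> g C'" "right_equivalent X \<pi> (g C) (g C')"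
    using assms[of "g ` Q"] Q(1,2) g(1) inj by (auto simp: card_image)
  have "right_equivalent X \<pi> (g C) x \<longleftrightarrow> right_equivalent X \<pi> (g C') x" for x
    using C(4) g(1)[OF C(1)] g(1)[OF C(2)] right_reach_trans[of "g C" y "g C'" x]
      right_reach_trans[of x y "g C'" "g C"] right_reach_trans[of "g C'" y "g C" x]
      right_reach_trans[of x y "g C" "g C'"]
    by (auto simp: right_equivalent_iff)
  then have "?r `` {g C} = ?r `` {g C'}" by auto
  then show False using g(2) C(1-3) by metis
qed

end

section \<open>Depth, t-depth and boolean rank\<close>

lemma INF_le_enat_iff:
  fixes g :: "'c \<Rightarrow> enat"
  shows "(INF x\<in>S. g x) \<le> enat k \<longleftrightarrow> (\<exists>x\<in>S. g x \<le> enat k)"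
proof
  assume *: "(INF x\<in>S. g x) \<le> enat k"
  show "\<exists>x\<in>S. g x \<le> enat k"
  proof (rule ccontr)
    assume "\<not> (\<exists>x\<in>S. g x \<le> enat k)"
    then have "\<forall>x\<in>S. enat (Suc k) \<le> g x"
      by (metis Suc_ile_eq not_le)
    then have "enat (Suc k) \<le> (INF x\<in>S. g x)" by (auto intro: INF_greatest)
    with * show False using order_trans by fastforce
  qed
next
  assume "\<exists>x\<in>S. g x \<le> enat k"
  then show "(INF x\<in>S. g x) \<le> enat k" by (meson INF_lower2)
qed

lemma ecard_le_enat_iff: "ecard M \<le> enat k \<longleftrightarrow> finite M \<and> card M \<le> k"
  by (auto simp: ecard_def)

lemma enat_le_if_bounds:
  fixes a b :: enat
  assumes "\<And>k. b \<le> enat k \<Longrightarrow> a \<le> enat k"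
  shows "a \<le> b"
  using assms by (cases b) auto

context vertex_code
begin

lemma steps_Cons_ends: "steps (b # v) = E O ends (b # v)"
proof -
  have "{(a, a') \<in> E. f a' = b} = E O Id_on {a \<in> Field E. f a = b}"
    by (auto simp: relcomp_unfold Id_on_iff Field_def)
  then show ?thesis by (simp add: ends_Cons_eq O_assoc)
qed

lemma ends_Cons_append: "ends (b # \<alpha> @ \<beta>) = ends (b # \<alpha>) O steps \<beta>"
  by (simp add: ends_Cons_eq label_steps_append O_assoc)

text \<open>Cutting and pasting preimages at the last position of \<open>w1\<close>.\<close>

lemma word_fibre_through:
  assumes "w1 \<noteq> []"
  shows "(\<exists>v\<in>word_fibre X \<pi> (w1 @ w2). hd v = a \<and> last v = c \<and> v ! (length w1 - 1) = e) \<longleftrightarrow>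
    (a, e) \<in> ends w1 \<and> (e, c) \<in> steps w2"
proof
  assume "\<exists>v\<in>word_fibre X \<pi> (w1 @ w2). hd v = a \<and> last v = c \<and> v ! (length w1 - 1) = e"
  then obtain v where v: "is_path v" "set v \<subseteq> Field E" "map f v = w1 @ w2"
    "hd v = a" "last v = c" "v ! (length w1 - 1) = e"
    using assms by (auto simp: word_fibre_iff)
  define v1 v2 where "v1 = take (length w1) v" and "v2 = drop (length w1) v"
  have app: "v = v1 @ v2" by (simp add: v1_def v2_def)
  have maps: "map f v1 = w1" "map f v2 = w2" using v(3) by (auto simp: v1_def v2_def take_map[symmetric] drop_map[symmetric])
  have "v1 \<noteq> []" using maps(1) assms by auto
  have "length v1 = length w1" using maps(1) by auto
  moreover have "length w1 - 1 < length w1" using assms by (cases w1) auto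
  ultimately have e: "e = last v1" using v(6) \<open>v1 \<noteq> []\<close> by (simp add: app nth_append last_conv_nth)
  have "v1 \<in> word_fibre X \<pi> w1" using v(1,2) maps(1) assms
    by (auto simp: word_fibre_iff app successively_append_iff)
  moreover have "hd v1 = a" using v(4) \<open>v1 \<noteq> []\<close> by (simp add: app)
  ultimately have "(a, e) \<in> ends w1" unfolding ends_def e by force
  moreover have "is_path (e # v2)" using v(1) \<open>v1 \<noteq> []\<close> e
    by (cases v2) (auto simp: app successively_append_iff)
  moreover have "last (e # v2) = c" using v(5) e by (cases v2) (auto simp: app)
  ultimately show "(a, e) \<in> ends w1 \<and> (e, c) \<in> steps w2"
    using maps(2) unfolding label_steps_iff_path by blast
next
  assume *: "(a, e) \<in> ends w1 \<and> (e, c) \<in> steps w2"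
  then obtain v1 where v1: "v1 \<in> word_fibre X \<pi> w1" "hd v1 = a" "last v1 = e" by (auto simp: ends_def)
  have v1': "is_path v1" "set v1 \<subseteq> Field E" "map f v1 = w1" using v1(1) assms by (auto simp: word_fibre_iff)
  have ne: "v1 \<noteq> []" using v1'(3) assms by auto
  obtain v2 where v2: "is_path (e # v2)" "map f v2 = w2" "last (e # v2) = c"
    using * unfolding label_steps_iff_path by blast
  have "set v2 \<subseteq> Field E"
  proof -
    have "set v \<subseteq> Range E" if "is_path (a # v)" for a v
      using that by (induction v arbitrary: a) auto
    then show ?thesis using v2(1) by (auto simp: Field_def)
  qed
  then have "v1 @ v2 \<in> word_fibre X \<pi> (w1 @ w2)"
    using v1' v2 v1(3) ne assms by (cases v2) (auto simp: word_fibre_iff successively_append_iff)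
  moreover have "hd (v1 @ v2) = a" using v1(2) ne by simp
  moreover have "last (v1 @ v2) = c" using v2(3) v1(3) ne by (auto split: if_splits)
  moreover have "(v1 @ v2) ! (length w1 - 1) = e"
    using v1'(3) v1(3) ne by (auto simp: nth_append last_conv_nth)
  ultimately show "\<exists>v\<in>word_fibre X \<pi> (w1 @ w2). hd v = a \<and> last v = c \<and> v ! (length w1 - 1) = e"
    by blast
qed

lemma fibre_routable_iff:
  assumes "w1 \<noteq> []"
  shows "fibre_routable X \<pi> (w1 @ w2) M (length w1) \<longleftrightarrow> ends (w1 @ w2) \<subseteq> ends w1 O Id_on M O steps w2"
proof -
  let ?F = "word_fibre X \<pi> (w1 @ w2)"
  have "routable X \<pi> u M (length w1) \<longleftrightarrow>
      (\<exists>v\<in>?F. hd v = hd u \<and> last v = last u \<and> v ! (length w1 - 1) \<in> M)" if "u \<in> ?F" for u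
  proof -
    have wm: "word_map X \<pi> u = w1 @ w2" using that by (simp add: word_fibre_def)
    moreover from this have "length u = length (w1 @ w2)" by (metis length_map word_map_def)
    ultimately show ?thesis unfolding routable_def word_fibre_def by auto
  qed
  also have "(\<exists>v\<in>?F. hd v = hd u \<and> last v = last u \<and> v ! (length w1 - 1) \<in> M) \<longleftrightarrow>
      (hd u, last u) \<in> ends w1 O Id_on M O steps w2" for u
  proof -
    have "(\<exists>v\<in>?F. hd v = hd u \<and> last v = last u \<and> v ! (length w1 - 1) \<in> M) \<longleftrightarrow>
      (\<exists>e\<in>M. \<exists>v\<in>?F. hd v = hd u \<and> last v = last u \<and> v ! (length w1 - 1) = e)" by blast
    then show ?thesis unfolding word_fibre_through[OF assms] by (auto simp: Id_on_iff)
  qed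
  finally show ?thesis unfolding fibre_routable_def ends_def[of "w1 @ w2"] by blast
qed

lemma depth_le_iff:
  "depth A X \<pi> w \<le> enat k \<longleftrightarrow> (\<exists>b \<alpha> \<beta> M. w = b # \<alpha> @ \<beta> \<and> \<alpha> \<noteq> [] \<and> \<beta> \<noteq> [] \<and> M \<subseteq> A \<and> card M \<le> k \<and>
     ends w \<subseteq> ends (b # \<alpha>) O Id_on M O steps \<beta>)" (is "_ \<longleftrightarrow> ?R")
proof -
  have "depth A X \<pi> w \<le> enat k \<longleftrightarrow> (\<exists>n M. 1 < n \<and> n < length w \<and> M \<subseteq> A \<and> card M \<le> k \<and> fibre_routable X \<pi> w M n)"
    unfolding depth_def INF_le_enat_iff ecard_le_enat_iff
    using finite_subset[OF _ finite_A] by auto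
  also have "\<dots> \<longleftrightarrow> ?R"
  proof
    assume "\<exists>n M. 1 < n \<and> n < length w \<and> M \<subseteq> A \<and> card M \<le> k \<and> fibre_routable X \<pi> w M n"
    then obtain n M where n: "1 < n" "n < length w" and M: "M \<subseteq> A" "card M \<le> k" "fibre_routable X \<pi> w M n"
      by blast
    obtain b v where w: "w = b # v" using n by (cases w) auto
    define \<alpha> \<beta> where "\<alpha> = take (n - 1) v" and "\<beta> = drop (n - 1) v"
    have app: "w = (b # \<alpha>) @ \<beta>" "\<alpha> \<noteq> []" "\<beta> \<noteq> []" "length (b # \<alpha>) = n"
      using n by (auto simp: w \<alpha>_def \<beta>_def)
    then have "ends w \<subseteq> ends (b # \<alpha>) O Id_on M O steps \<beta>"
      using M(3) fibre_routable_iff[of "b # \<alpha>" \<beta> M] by simp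
    then show ?R using app M(1,2) by auto
  next
    assume ?R
    then obtain b \<alpha> \<beta> M where *: "w = b # \<alpha> @ \<beta>" "\<alpha> \<noteq> []" "\<beta> \<noteq> []" "M \<subseteq> A" "card M \<le> k"
     "ends w \<subseteq> ends (b # \<alpha>) O Id_on M O steps \<beta>" by blast
    then have "fibre_routable X \<pi> w M (length (b # \<alpha>))"
      using fibre_routable_iff[of "b # \<alpha>" \<beta> M] by simp
    then show "\<exists>n M. 1 < n \<and> n < length w \<and> M \<subseteq> A \<and> card M \<le> k \<and> fibre_routable X \<pi> w M n"
      using * by (intro exI[of _ "length (b # \<alpha>)"] exI[of _ M]) auto
  qed
  finally show ?thesis .
qed

text \<open>A routing of \<open>w\<close> serves every longer word.\<close>

lemma depth_le_extend:
  assumes "depth A X \<pi> w \<le> enat k"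
  shows "depth A X \<pi> (u @ w @ v) \<le> enat k"
proof -
  obtain b \<alpha> \<beta> M where *: "w = b # \<alpha> @ \<beta>" "\<alpha> \<noteq> []" "\<beta> \<noteq> []" "M \<subseteq> A" "card M \<le> k"
     "ends w \<subseteq> ends (b # \<alpha>) O Id_on M O steps \<beta>"
    using assms unfolding depth_le_iff by blast
  have right: "ends (b # \<alpha> @ \<beta> @ v) \<subseteq> ends (b # \<alpha>) O Id_on M O steps (\<beta> @ v)"
    using *(6) ends_Cons_append[of b "\<alpha> @ \<beta>" v] unfolding *(1)
    by (auto simp: label_steps_append) blast
  show ?thesis
  proof (cases u)
    case Nil
    then show ?thesis unfolding depth_le_iff
      using * right by (intro exI[of _ b] exI[of _ \<alpha>] exI[of _ "\<beta> @ v"] exI[of _ M]) auto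
  next
    case (Cons b' u')
    have "ends (b' # u' @ b # z) = Id_on {a \<in> Field E. f a = b'} O steps u' O E O ends (b # z)" for z
      using steps_Cons_ends by (simp add: ends_Cons_eq label_steps_append O_assoc)
    then have "ends (b' # (u' @ b # \<alpha>) @ \<beta> @ v) \<subseteq> ends (b' # (u' @ b # \<alpha>)) O Id_on M O steps (\<beta> @ v)"
      using right by simp blast
    then show ?thesis unfolding depth_le_iff
      using * Cons by (intro exI[of _ b'] exI[of _ "u' @ b # \<alpha>"] exI[of _ "\<beta> @ v"] exI[of _ M]) auto
  qed
qed

text \<open>A tangled set \<open>S\<close> gives the rectangle of its first and last symbols, which lies in \<open>ends w\<close> since
  bridges exist in \<open>S\<close>. Conversely, assign each preimage to one rectangle that contains its pair of
  end symbols; preimages in one rectangle are tangled.\<close>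

lemma t_depth_le_iff:
  assumes "w \<noteq> []"
  shows "t_depth X \<pi> w \<le> enat k \<longleftrightarrow> boolean_rank_le (ends w) k"
proof -
  let ?F = "word_fibre X \<pi> w"
  have F: "length u = length w" "word_map X \<pi> u = w" if "u \<in> ?F" for u
    using that by (auto simp: word_fibre_def word_map_def)
  have bridge: "(\<exists>v. word_bridge X \<pi> u u' v) \<longleftrightarrow> (hd u, last u') \<in> ends w" if "u \<in> ?F" "u' \<in> ?F" for u u'
  proof -
    have "word_bridge X \<pi> u u' v \<longleftrightarrow> v \<in> ?F \<and> hd v = hd u \<and> last v = last u'" for v
      using F[OF that(1)] F[OF that(2)] by (auto simp: word_bridge_def word_fibre_def)
    then have "(\<exists>v. word_bridge X \<pi> u u' v) \<longleftrightarrow> (\<exists>v\<in>?F. hd v = hd u \<and> last v = last u')" by blast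
    also have "\<dots> \<longleftrightarrow> (hd u, last u') \<in> ends w" unfolding ends_def image_iff prod.inject by metis
    finally show ?thesis .
  qed
  have tangled_iff: "tangled X \<pi> S \<longleftrightarrow> (\<forall>u\<in>S. \<forall>u'\<in>S. (hd u, last u') \<in> ends w)" if "S \<subseteq> ?F" for S
    unfolding tangled_def using bridge that by (meson subsetD)
  have "t_depth X \<pi> w \<le> enat k \<longleftrightarrow>
    (\<exists>P. partition_on ?F P \<and> (\<forall>S\<in>P. tangled X \<pi> S) \<and> finite P \<and> card P \<le> k)"
    unfolding t_depth_def INF_le_enat_iff ecard_le_enat_iff by blast
  also have "\<dots> \<longleftrightarrow> boolean_rank_le (ends w) k"
  proof
    assume "\<exists>P. partition_on ?F P \<and> (\<forall>S\<in>P. tangled X \<pi> S) \<and> finite P \<and> card P \<le> k"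
    then obtain P where P: "partition_on ?F P" "\<And>S. S \<in> P \<Longrightarrow> tangled X \<pi> S" "finite P" "card P \<le> k" by blast
    let ?U = "{(hd u, S) | u S. u \<in> S}" and ?V = "{(S, last u) | u S. u \<in> S}"
    have un: "\<Union>P = ?F" using P(1) by (auto simp: partition_on_def)
    have "ends w = ?U O Id_on P O ?V"
    proof (intro subset_antisym subsetI)
      fix x assume "x \<in> ends w"
      then obtain u where "u \<in> ?F" "x = (hd u, last u)" by (auto simp: ends_def)
      moreover from this obtain S where "u \<in> S" "S \<in> P" using un by blast
      ultimately show "x \<in> ?U O Id_on P O ?V" by (auto simp: relcomp_unfold Id_on_iff)
    next
      fix x assume "x \<in> ?U O Id_on P O ?V"
      then obtain S u u' where S: "S \<in> P" "u \<in> S" "u' \<in> S" "x = (hd u, last u')" by auto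
      then show "x \<in> ends w" using tangled_iff[of S] P(2)[OF S(1)] un by blast
    qed
    then show "boolean_rank_le (ends w) k" by (rule boolean_rank_le_factor) (use P in auto)
  next
    assume "boolean_rank_le (ends w) k"
    then obtain U V where UV: "ends w = U O Id_on {..<k} O V" unfolding boolean_rank_le_def by blast
    have "\<forall>u\<in>?F. \<exists>i<k. (hd u, i) \<in> U \<and> (i, last u) \<in> V"
    proof
      fix u assume "u \<in> ?F"
      then have "(hd u, last u) \<in> ends w" by (auto simp: ends_def)
      then show "\<exists>i<k. (hd u, i) \<in> U \<and> (i, last u) \<in> V" unfolding UV by (auto simp: Id_on_iff)
    qed
    then obtain g where g: "\<And>u. u \<in> ?F \<Longrightarrow> g u < k \<and> (hd u, g u) \<in> U \<and> (g u, last u) \<in> V" by metis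
    define P where "P = (\<lambda>i. {u \<in> ?F. g u = i}) ` g ` ?F"
    have gk: "g ` ?F \<subseteq> {..<k}" using g by auto
    then have fin: "finite (g ` ?F)" "card (g ` ?F) \<le> k"
      using finite_subset card_mono[OF _ gk] by auto
    have "partition_on ?F P"
      by (rule partition_onI) (auto simp: P_def disjnt_def)
    moreover have "tangled X \<pi> S" if "S \<in> P" for S
    proof -
      obtain i where S: "S = {u \<in> ?F. g u = i}" using \<open>S \<in> P\<close> unfolding P_def by (elim imageE)
      have "(hd u, last u') \<in> ends w" if "u \<in> S" "u' \<in> S" for u u'
        unfolding UV using that g[of u] g[of u'] by (auto simp: S Id_on_iff intro!: relcompI)
      then show ?thesis using tangled_iff[of S] S by blast
    qed
    moreover have "finite P" "card P \<le> k"
      using fin card_image_le[OF fin(1), of "\<lambda>i. {u \<in> ?F. g u = i}"] by (auto simp: P_def)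
    ultimately show "\<exists>P. partition_on ?F P \<and> (\<forall>S\<in>P. tangled X \<pi> S) \<and> finite P \<and> card P \<le> k" by blast
  qed
  finally show ?thesis .
qed

lemma depth_le_factor:
  assumes "depth A X \<pi> w \<le> enat k"
  obtains b \<alpha> \<beta> M where "w = b # \<alpha> @ \<beta>" "\<alpha> \<noteq> []" "\<beta> \<noteq> []" "finite M" "card M \<le> k"
    "ends w = ends (b # \<alpha>) O Id_on M O steps \<beta>"
proof -
  obtain b \<alpha> \<beta> M where *: "w = b # \<alpha> @ \<beta>" "\<alpha> \<noteq> []" "\<beta> \<noteq> []" "M \<subseteq> A" "card M \<le> k"
     "ends w \<subseteq> ends (b # \<alpha>) O Id_on M O steps \<beta>"
    using assms unfolding depth_le_iff by blast
  have "finite M" using *(4) finite_A by (rule finite_subset)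
  moreover have "ends w = ends (b # \<alpha>) O Id_on M O steps \<beta>"
    using *(6) unfolding *(1) ends_Cons_append by auto
  ultimately show ?thesis using that * by blast
qed

lemma t_depth_le_depth: "t_depth X \<pi> w \<le> depth A X \<pi> w"
proof (rule enat_le_if_bounds)
  fix k assume "depth A X \<pi> w \<le> enat k"
  then obtain b \<alpha> \<beta> M where *: "w = b # \<alpha> @ \<beta>" "finite M" "card M \<le> k"
    "ends w = ends (b # \<alpha>) O Id_on M O steps \<beta>" by (rule depth_le_factor)
  have "boolean_rank_le (ends w) k" using *(4,2,3) by (rule boolean_rank_le_factor)
  then show "t_depth X \<pi> w \<le> enat k" using *(1) by (simp add: t_depth_le_iff)
qed

lemma depth_le_routes:
  assumes "depth A X \<pi> w \<le> enat k"
  shows "\<exists>M \<alpha> \<beta>. w = \<alpha> @ \<beta> \<and> \<alpha> \<noteq> [] \<and> \<beta> \<noteq> [] \<and> routes M \<alpha> \<beta> \<and> card M \<le> k"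
proof -
  obtain b \<alpha> \<beta> M where *: "w = b # \<alpha> @ \<beta>" "\<beta> \<noteq> []" "finite M" "card M \<le> k"
    "ends w = ends (b # \<alpha>) O Id_on M O steps \<beta>" using assms by (rule depth_le_factor)
  have "steps ((b # \<alpha>) @ \<beta>) = E O ends w"
    using steps_Cons_ends[of b "\<alpha> @ \<beta>"] *(1) by simp
  also have "\<dots> = steps (b # \<alpha>) O Id_on M O steps \<beta>"
    unfolding *(5) using steps_Cons_ends[of b \<alpha>] by (simp only: O_assoc)
  finally have "routes M (b # \<alpha>) \<beta>" using *(3) by (simp add: routes_def)
  then show ?thesis using * by (intro exI[of _ M] exI[of _ "b # \<alpha>"] exI[of _ \<beta>]) auto
qed

text \<open>Prefixing the label of a starting vertex turns \<open>steps w\<close> into a factor of \<open>ends\<close> of a word of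
  the language.\<close>

lemma steps_boolean_rank:
  assumes min: "\<And>w. w \<in> language Y \<Longrightarrow> enat d \<le> t_depth X \<pi> w"
    and "w \<noteq> []" "steps w \<noteq> {}" "boolean_rank_le (steps w) k"
  shows "d \<le> k"
proof -
  obtain a c where ac: "(a, c) \<in> steps w" using assms(3) by auto
  let ?w = "f a # w"
  have "a \<in> Field E" using label_steps_edge(1)[OF ac assms(2)] .
  then have "(a, c) \<in> ends ?w" using ac by (simp add: ends_Cons del: label_steps.simps)
  then have "?w \<in> language Y" by (auto simp: language_Y_iff)
  then have "enat d \<le> t_depth X \<pi> ?w" by (rule min)
  moreover have "boolean_rank_le (ends ?w) k"
    using boolean_rank_le_relcomp[OF assms(4), of "Id_on {x \<in> Field E. f x = f a}" Id]
    by (simp add: ends_Cons_eq)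
  then have "t_depth X \<pi> ?w \<le> enat k" by (simp add: t_depth_le_iff)
  ultimately have "enat d \<le> enat k" by (rule order_trans)
  then show ?thesis by simp
qed

section \<open>Comparing depths with numbers of classes\<close>

lemma word_at_Suc: "word_at y i (Suc n) = y i # word_at y (i + 1) n"
  by (rule nth_equalityI) (auto simp: nth_Cons algebra_simps split: nat.splits)

lemma steps_word_at: "steps (word_at y i n) = reach y (i - 1) (i - 1 + int n)"
  by (simp add: reach_def)

lemma ends_word_at:
  assumes "n > 0"
  shows "ends (word_at y i n) = Id_on {a \<in> Field E. f a = y i} O reach y i (i + int n - 1)"
proof -
  obtain k where "n = Suc k" using assms gr0_implies_Suc by blast
  then show ?thesis by (simp add: word_at_Suc ends_Cons_eq steps_word_at)
qed

lemma word_at_in_words: "y \<in> Y \<Longrightarrow> word_at y i n \<in> words Y n"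
  by (auto simp: words_def)

lemma words_in_language: "n > 0 \<Longrightarrow> words Y n \<subseteq> language Y"
  using UN_upper[of n "{1..}" "words Y"] by (simp add: language_def)

lemma shift_in_X: "x \<in> X \<Longrightarrow> (\<lambda>i. x (i + j)) \<in> X"
  unfolding in_X_iff by (metis add.commute add.left_commute)

lemma code_in_Y: "x \<in> X \<Longrightarrow> \<pi> x \<in> Y"
  by (simp add: Y_eq)

text \<open>Whether a point passes to \<open>z\<close> depends only on its symbol at time 0. There are finitely many symbols
  and finitely many \<open>z\<close>, and having met \<open>z\<close> one can follow it up to any later time.\<close>

lemma common_meeting_time:
  assumes "Z \<subseteq> fibre X \<pi> y" "finite Z"
  obtains p where "p > 0"
    "\<And>a z q. a \<in> Field E \<Longrightarrow> z \<in> Z \<Longrightarrow> q > 0 \<Longrightarrow> (a, z q) \<in> reach y 0 q \<Longrightarrow> (a, z p) \<in> reach y 0 p"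
proof -
  define Q where "Q = {(a, z). a \<in> Field E \<and> z \<in> Z \<and> (\<exists>q>0. (a, z q) \<in> reach y 0 q)}"
  have "Q \<subseteq> Field E \<times> Z" by (auto simp: Q_def)
  then have "finite Q" by (rule finite_subset) (simp add: finite_vertices assms(2))
  have "\<forall>az\<in>Q. \<exists>q>0. (fst az, snd az q) \<in> reach y 0 q" by (auto simp: Q_def)
  then obtain g where g: "\<And>az. az \<in> Q \<Longrightarrow> g az > 0 \<and> (fst az, snd az (g az)) \<in> reach y 0 (g az)" by metis
  define p where "p = Max (insert (1::int) (g ` Q))"
  have p1: "p \<ge> 1" unfolding p_def using \<open>finite Q\<close> by simp
  have pg: "g az \<le> p" if "az \<in> Q" for az unfolding p_def using \<open>finite Q\<close> that by simp
  show ?thesis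
  proof (rule that[of p])
    show "p > 0" using p1 by simp
    fix a z q assume *: "a \<in> Field E" "z \<in> Z" "q > 0" "(a, z q) \<in> reach y 0 q"
    then have Q: "(a, z) \<in> Q" by (auto simp: Q_def)
    then have "(a, z (g (a, z))) \<in> reach y 0 (g (a, z))" "0 < g (a, z)" using g[OF Q] by auto
    moreover have "(z (g (a, z)), z p) \<in> reach y (g (a, z)) p"
      using reach_fibre[of z y] *(2) assms(1) pg[OF Q] by auto
    ultimately show "(a, z p) \<in> reach y 0 p" using pg[OF Q] by (meson less_imp_le reach_trans)
  qed
qed

text \<open>Take representatives \<open>Z\<close> of the classes and a time \<open>p\<close> by which every point of the fibre
  can have passed from time 0 to its representative. If no window had small depth, each large window would
  carry a path that cannot visit any \<open>z p\<close> and return to its own last symbol. A limit \<open>x\<close> of these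
  paths lies in the fibre, so it can pass to some \<open>z\<close> at time \<open>p\<close> and back at a finite time \<open>q\<close>;
  paths that agree with \<open>x\<close> from time 0 to time \<open>q\<close> can do the same.\<close>

lemma depth_window_le:
  assumes "num_right_classes X \<pi> y \<le> enat k"
  shows "\<exists>n. depth A X \<pi> (word_at y (- int n) (2 * n + 1)) \<le> enat k"
proof (rule ccontr)
  assume deep: "\<not> ?thesis"
  obtain Z where Z: "Z \<subseteq> fibre X \<pi> y" "finite Z" "card Z \<le> k"
    "\<And>x. x \<in> fibre X \<pi> y \<Longrightarrow> \<exists>z\<in>Z. right_equivalent X \<pi> z x"
    using num_right_classes_le_representatives[OF assms] by blast
  obtain p where p: "p > 0" "\<And>a z q. a \<in> Field E \<Longrightarrow> z \<in> Z \<Longrightarrow> q > 0 \<Longrightarrow>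
      (a, z q) \<in> reach y 0 q \<Longrightarrow> (a, z p) \<in> reach y 0 p"
    using common_meeting_time[OF Z(1,2)] by blast
  define M where "M = (\<lambda>z. z p) ` Z"
  have "z p \<in> A" if "z \<in> Z" for z
    using that Z(1) in_X_vertex[of z p] vertices by (auto simp: fibre_def)
  then have M: "M \<subseteq> A" "card M \<le> k"
    using card_image_le[OF Z(2), of "\<lambda>z. z p"] Z(3) by (auto simp: M_def)
  have "\<exists>t. (\<forall>i. t i \<in> Field E) \<and>
      (\<forall>i. - (int n + p) \<le> i \<and> i < int n + p \<longrightarrow> (t i, t (i + 1)) \<in> E) \<and>
      (\<forall>i. - (int n + p) \<le> i \<and> i \<le> int n + p \<longrightarrow> f (t i) = y i) \<and>
      (\<forall>z\<in>Z. (t (- (int n + p)), z p) \<in> reach y (- (int n + p)) p \<longrightarrow> (z p, t (int n + p)) \<notin> reach y p (int n + p))"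
    if n: "n > 0" for n
  proof -
    define K where "K = int n + p"
    have K: "K > p" "K > 0" using n p(1) by (auto simp: K_def)
    define b \<alpha> \<beta> where "b = y (- K)" and "\<alpha> = word_at y (- K + 1) (nat (K + p))"
      and "\<beta> = word_at y (p + 1) (nat (K - p))"
    have "2 * nat K + 1 = Suc (nat (K + p) + nat (K - p))" using K p(1) by linarith
    moreover have "- K + 1 + int (nat (K + p)) = p + 1" using K p(1) by simp
    ultimately have w: "word_at y (- K) (2 * nat K + 1) = b # \<alpha> @ \<beta>"
      unfolding b_def \<alpha>_def \<beta>_def by (simp only: word_at_Suc word_at_append)
    have "\<alpha> \<noteq> []" "\<beta> \<noteq> []"
      using K p(1) unfolding \<alpha>_def \<beta>_def by (auto simp flip: length_greater_0_conv)
    moreover have "\<not> depth A X \<pi> (b # \<alpha> @ \<beta>) \<le> enat k"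
      using deep w K by (metis int_nat_eq less_imp_le)
    ultimately have "\<not> ends (b # \<alpha> @ \<beta>) \<subseteq> ends (b # \<alpha>) O Id_on M O steps \<beta>"
      using M unfolding depth_le_iff by blast
    then obtain a c where ac: "(a, c) \<in> ends (b # \<alpha> @ \<beta>)" "(a, c) \<notin> ends (b # \<alpha>) O Id_on M O steps \<beta>"
      by auto
    have s: "steps \<alpha> = reach y (- K) p" "steps \<beta> = reach y p K"
      using K p(1) by (simp_all add: \<alpha>_def \<beta>_def reach_def add.commute)
    have a: "a \<in> Field E" "f a = y (- K)" "(a, c) \<in> reach y (- K) K"
      using ac(1) K p(1) by (simp_all add: ends_Cons label_steps_append s reach_comp b_def)
    then obtain t where t: "t (- K) = a" "t K = c" "\<forall>i. - K \<le> i \<and> i < K \<longrightarrow> (t i, t (i + 1)) \<in> E"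
      "\<forall>i. - K < i \<and> i \<le> K \<longrightarrow> f (t i) = y i" using path_of_reach[OF _ a(3)] K by auto
    \<comment> \<open>Outside the window any vertex will do; \<open>limit_point\<close> only asks for values in a finite set.\<close>
    define t' where "t' i = (if - K \<le> i \<and> i \<le> K then t i else a)" for i
    have "t i \<in> Field E" if "- K \<le> i" "i \<le> K" for i
    proof (cases "i = - K")
      case False
      then have "(t (i - 1), t i) \<in> E" using t(3)[rule_format, of "i - 1"] that by simp
      then show ?thesis by (auto simp: Field_def)
    qed (use t(1) a(1) in simp)
    then have "\<forall>i. t' i \<in> Field E" using a(1) by (simp add: t'_def)
    moreover have "\<forall>i. - K \<le> i \<and> i < K \<longrightarrow> (t' i, t' (i + 1)) \<in> E" using t(3) by (auto simp: t'_def)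
    moreover have "\<forall>i. - K \<le> i \<and> i \<le> K \<longrightarrow> f (t' i) = y i"
      using t(1,4) a(2) by (auto simp: t'_def) (metis le_less)
    moreover have "(z p, t' K) \<notin> reach y p K" if "z \<in> Z" "(t' (- K), z p) \<in> reach y (- K) p" for z
    proof
      assume "(z p, t' K) \<in> reach y p K"
      then have "(a, z p) \<in> ends (b # \<alpha>)" "(z p, c) \<in> steps \<beta>" "z p \<in> M"
        using that a K t(1,2) by (auto simp: ends_Cons s t'_def M_def b_def)
      then show False using ac(2) by auto
    qed
    ultimately show ?thesis unfolding K_def by blast
  qed
  then have "\<forall>n. \<exists>t. (\<forall>i. t i \<in> Field E) \<and>
      (\<forall>i. - (int (Suc n) + p) \<le> i \<and> i < int (Suc n) + p \<longrightarrow> (t i, t (i + 1)) \<in> E) \<and>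
      (\<forall>i. - (int (Suc n) + p) \<le> i \<and> i \<le> int (Suc n) + p \<longrightarrow> f (t i) = y i) \<and>
      (\<forall>z\<in>Z. (t (- (int (Suc n) + p)), z p) \<in> reach y (- (int (Suc n) + p)) p \<longrightarrow>
        (z p, t (int (Suc n) + p)) \<notin> reach y p (int (Suc n) + p))" by blast
  \<comment> \<open>The shift of the index by \<open>p + 1\<close> makes every window reach beyond \<open>p\<close>.\<close>
  from choice[OF this] obtain s where s: "\<And>n i. s n i \<in> Field E"
    "\<And>n i. - (int (Suc n) + p) \<le> i \<Longrightarrow> i < int (Suc n) + p \<Longrightarrow> (s n i, s n (i + 1)) \<in> E"
    "\<And>n i. - (int (Suc n) + p) \<le> i \<Longrightarrow> i \<le> int (Suc n) + p \<Longrightarrow> f (s n i) = y i"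
    "\<And>n z. z \<in> Z \<Longrightarrow> (s n (- (int (Suc n) + p)), z p) \<in> reach y (- (int (Suc n) + p)) p \<Longrightarrow>
        (z p, s n (int (Suc n) + p)) \<notin> reach y p (int (Suc n) + p)"
    by blast
  have "\<exists>x\<in>X. \<forall>k::nat. \<exists>n\<ge>k. \<forall>i. \<bar>i\<bar> \<le> int k \<longrightarrow> x i = s n i"
    by (rule limit_point) (use s(1,2) p(1) in auto)
  then obtain x where x: "x \<in> X" "\<And>k::nat. \<exists>n\<ge>k. \<forall>i. \<bar>i\<bar> \<le> int k \<longrightarrow> x i = s n i" by blast
  have "f (x i) = y i" for i
  proof -
    obtain n where "n \<ge> nat \<bar>i\<bar>" "x i = s n i" using x(2)[of "nat \<bar>i\<bar>"] by auto
    then show ?thesis using s(3)[of n i] p(1) by auto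
  qed
  then have xf: "x \<in> fibre X \<pi> y" using x(1) by (simp add: in_fibre_iff)
  then obtain z where z: "z \<in> Z" "right_equivalent X \<pi> z x" using Z(4) by blast
  have zf: "z \<in> fibre X \<pi> y" using z(1) Z(1) by blast
  have rr: "right_reach X \<pi> x z" "right_reach X \<pi> z x"
    using z(2) by (auto simp: right_equivalent_def)
  obtain q where "q > 0" "(x 0, z q) \<in> reach y 0 q"
    using rr(1) unfolding right_reach_iff[OF xf zf] by blast
  then have xz: "(x 0, z p) \<in> reach y 0 p" using p(2) z(1) in_X_vertex[OF x(1)] by blast
  obtain q where q: "q > p" "(z p, x q) \<in> reach y p q"
    using rr(2) unfolding right_reach_iff[OF zf xf] by blast
  obtain n where n: "n \<ge> nat q" "\<And>i. \<bar>i\<bar> \<le> int (nat q) \<Longrightarrow> x i = s n i" using x(2) by blast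
  define N where "N = int (Suc n) + p"
  have N: "N \<ge> q" "N > 0" using n(1) p(1) q(1) by (auto simp: N_def)
  have sr: "(s n i, s n j) \<in> reach y i j" if "- N \<le> i" "i \<le> j" "j \<le> N" for i j
    by (rule reach_path) (use that s(2,3) in \<open>auto simp: N_def\<close>)
  have "x 0 = s n 0" "x q = s n q" using n(2) q(1) p(1) by auto
  then have "(s n (- N), z p) \<in> reach y (- N) p" "(z p, s n N) \<in> reach y p N"
    using sr[of "- N" 0] sr[of q N] xz q N p(1) reach_trans[of "s n (- N)" "s n 0" y "- N" 0 "z p" p]
      reach_trans[of "z p" "s n q" y p q "s n N" N] by auto
  then show False using s(4)[OF z(1), of n] by (simp add: N_def)
qed

text \<open>Connections both ways in windows arbitrarily far to the right would give bridges from every \<open>m\<close>.\<close>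

lemma not_right_equivalent_eventually:
  assumes "x \<in> fibre X \<pi> y" "x' \<in> fibre X \<pi> y" "\<not> right_equivalent X \<pi> x x'"
  shows "\<exists>m. \<forall>i\<ge>m. \<forall>j\<ge>i. \<not> ((x i, x' j) \<in> reach y i j \<and> (x' i, x j) \<in> reach y i j)"
proof (rule ccontr)
  assume "\<not> ?thesis"
  then have *: "\<exists>i\<ge>m. \<exists>j\<ge>i. (x i, x' j) \<in> reach y i j \<and> (x' i, x j) \<in> reach y i j" for m by blast
  have ext: "(z m, z' (j + 1)) \<in> reach y m (j + 1)"
    if "z \<in> fibre X \<pi> y" "z' \<in> fibre X \<pi> y" "m \<le> i" "i \<le> j" "(z i, z' j) \<in> reach y i j" for z z' m i j
  proof -
    have "(z m, z' j) \<in> reach y m j" using reach_trans[OF reach_fibre] that by blast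
    then show ?thesis using reach_trans[OF _ reach_fibre, of "z m" z' j y m "j + 1"] that by auto
  qed
  have "right_reach X \<pi> x x'"
    unfolding right_reach_iff[OF assms(1,2)]
  proof
    fix m
    obtain i j where "i \<ge> m" "j \<ge> i" "(x i, x' j) \<in> reach y i j" using * by blast
    then show "\<exists>n>m. (x m, x' n) \<in> reach y m n" using ext[of x x' m i j] assms by (intro exI[of _ "j + 1"]) auto
  qed
  moreover have "right_reach X \<pi> x' x"
    unfolding right_reach_iff[OF assms(2,1)]
  proof
    fix m
    obtain i j where "i \<ge> m" "j \<ge> i" "(x' i, x j) \<in> reach y i j" using * by blast
    then show "\<exists>n>m. (x' m, x n) \<in> reach y m n" using ext[of x' x m i j] assms by (intro exI[of _ "j + 1"]) auto
  qed
  ultimately show False using assms by (simp add: right_equivalent_iff)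
qed

text \<open>Suppose that \<open>k + 1\<close> points are pairwise inequivalent. Beyond some time no two of them are connected
  both ways, but in a later window covered by \<open>k\<close> rectangles two of them share a rectangle.\<close>

lemma num_right_classes_le:
  assumes rec: "\<And>m. \<exists>i\<ge>m. \<exists>n>0. t_depth X \<pi> (word_at y i n) \<le> enat k"
  shows "num_right_classes X \<pi> y \<le> enat k"
proof (rule num_right_classes_leI, rule ccontr)
  fix F assume F: "finite F" "F \<subseteq> fibre X \<pi> y" "card F = Suc k"
    and neq: "\<not> (\<exists>x\<in>F. \<exists>x'\<in>F. x \<noteq> x' \<and> right_equivalent X \<pi> x x')"
  have "\<forall>P\<in>{P \<in> F \<times> F. fst P \<noteq> snd P}. \<exists>m. \<forall>i\<ge>m. \<forall>j\<ge>i.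
      \<not> ((fst P i, snd P j) \<in> reach y i j \<and> (snd P i, fst P j) \<in> reach y i j)"
  proof
    fix P assume "P \<in> {P \<in> F \<times> F. fst P \<noteq> snd P}"
    then have P: "fst P \<in> F" "snd P \<in> F" "fst P \<noteq> snd P" by auto
    then have "\<not> right_equivalent X \<pi> (fst P) (snd P)" using neq by blast
    then show "\<exists>m. \<forall>i\<ge>m. \<forall>j\<ge>i. \<not> ((fst P i, snd P j) \<in> reach y i j \<and> (snd P i, fst P j) \<in> reach y i j)"
      using P F(2) by (intro not_right_equivalent_eventually) auto
  qed
  from bchoice[OF this] obtain g where g: "\<And>P i j. P \<in> F \<times> F \<Longrightarrow> fst P \<noteq> snd P \<Longrightarrow> g P \<le> i \<Longrightarrow> i \<le> j \<Longrightarrow>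
      \<not> ((fst P i, snd P j) \<in> reach y i j \<and> (snd P i, fst P j) \<in> reach y i j)"
    by blast
  define m where "m = Max (g ` (F \<times> F))"
  have gm: "g P \<le> m" if "P \<in> F \<times> F" for P unfolding m_def using F(1) that by simp
  obtain i n where i: "i \<ge> m" "n > 0" "t_depth X \<pi> (word_at y i n) \<le> enat k" using rec by blast
  define j where "j = i + int n - 1"
  have j: "i \<le> j" using i(2) by (simp add: j_def)
  have "word_at y i n \<noteq> []" using i(2) by (auto simp flip: length_greater_0_conv)
  then obtain U V where UV: "ends (word_at y i n) = U O Id_on {..<k} O V"
    using i(3) unfolding t_depth_le_iff[OF \<open>word_at y i n \<noteq> []\<close>] boolean_rank_le_def by blast
  have e: "ends (word_at y i n) = Id_on {a \<in> Field E. f a = y i} O reach y i j"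
    using ends_word_at[OF i(2)] by (simp add: j_def)
  have "\<forall>x\<in>F. \<exists>l<k. (x i, l) \<in> U \<and> (l, x j) \<in> V"
  proof
    fix x assume "x \<in> F"
    then have x: "x \<in> fibre X \<pi> y" using F(2) by blast
    then have "(x i, x j) \<in> ends (word_at y i n)"
      unfolding e using reach_fibre[OF x j] in_X_vertex by (auto simp: in_fibre_iff intro!: relcompI)
    then show "\<exists>l<k. (x i, l) \<in> U \<and> (l, x j) \<in> V" unfolding UV by (auto simp: Id_on_iff)
  qed
  then obtain l where l: "\<And>x. x \<in> F \<Longrightarrow> l x < k \<and> (x i, l x) \<in> U \<and> (l x, x j) \<in> V" by metis
  have "l ` F \<subseteq> {..<k}" using l by auto
  then have "card (l ` F) \<le> k" using card_mono[of "{..<k}"] by auto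
  then have "\<not> inj_on l F" using F(3) by (auto dest: card_image)
  then obtain x x' where x: "x \<in> F" "x' \<in> F" "x \<noteq> x'" "l x = l x'" by (auto simp: inj_on_def)
  have "(x i, x' j) \<in> ends (word_at y i n)" "(x' i, x j) \<in> ends (word_at y i n)"
    unfolding UV using l[OF x(1)] l[OF x(2)] x(4) by (auto simp: Id_on_iff intro!: relcompI)
  then have "(x i, x' j) \<in> reach y i j" "(x' i, x j) \<in> reach y i j" unfolding e by auto
  then show False using g[of "(x, x')" i j] gm[of "(x, x')"] x i(1) j by auto
qed

lemma few_classes_somewhere:
  assumes "w \<in> language Y" "t_depth X \<pi> w \<le> enat k"
  shows "\<exists>y\<in>Y. num_right_classes X \<pi> y \<le> enat k"
proof -
  have w: "w \<noteq> []" "ends w \<noteq> {}" using assms(1) by (auto simp: language_Y_iff)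
  then obtain u where u: "u \<in> word_fibre X \<pi> w" by (auto simp: ends_def)
  then have u': "is_path u" "set u \<subseteq> Field E" "map f u = w" using w(1) by (auto simp: word_fibre_iff)
  then obtain x where x: "x \<in> X" "\<And>m. \<exists>i\<ge>m. word_at x i (length u) = u"
    using recurrent_point[of u] w(1) by auto
  have "\<exists>i\<ge>m. \<exists>n>0. t_depth X \<pi> (word_at (\<pi> x) i n) \<le> enat k" for m
  proof -
    obtain i where i: "i \<ge> m" "word_at x i (length u) = u" using x(2) by blast
    have "word_at (\<pi> x) i (length u) = w" using word_at_code[OF x(1)] i(2) u'(3) by simp
    then show ?thesis using i(1) assms(2) w(1) u'(3) by (intro exI[of _ i] conjI exI[of _ "length u"]) auto
  qed
  then show ?thesis using num_right_classes_le code_in_Y[OF x(1)] by blast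
qed

text \<open>Otherwise there are points with arbitrarily long central windows of large depth. A limit point has some
  window of small depth, which lies inside these long windows.\<close>

lemma uniform_depth_bound:
  assumes "\<And>y. y \<in> Y \<Longrightarrow> num_right_classes X \<pi> y \<le> enat k"
  shows "\<exists>N>0. \<forall>w\<in>words Y N. depth A X \<pi> w \<le> enat k"
proof (rule ccontr)
  assume "\<not> ?thesis"
  then have neg: "\<And>N. N > 0 \<Longrightarrow> \<exists>w\<in>words Y N. \<not> depth A X \<pi> w \<le> enat k" by blast
  have "\<forall>n. \<exists>x\<in>X. \<not> depth A X \<pi> (word_at (\<pi> x) (- int n) (2 * n + 1)) \<le> enat k"
  proof
    fix n
    obtain x i where x: "x \<in> X" "\<not> depth A X \<pi> (word_at (\<pi> x) i (2 * n + 1)) \<le> enat k"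
      using neg[of "2 * n + 1"] by (auto simp: words_def Y_eq)
    \<comment> \<open>Move the deep word to the window centred at 0.\<close>
    let ?x = "\<lambda>j. x (j + (i + int n))"
    have "word_at (\<pi> ?x) (- int n) (2 * n + 1) = word_at (\<pi> x) i (2 * n + 1)"
      by (rule nth_equalityI) (auto simp: code x(1) shift_in_X algebra_simps)
    then show "\<exists>x\<in>X. \<not> depth A X \<pi> (word_at (\<pi> x) (- int n) (2 * n + 1)) \<le> enat k"
      using x shift_in_X by (intro bexI[of _ ?x]) auto
  qed
  then obtain s where s: "\<And>n. s n \<in> X"
    "\<And>n. \<not> depth A X \<pi> (word_at (\<pi> (s n)) (- int n) (2 * n + 1)) \<le> enat k" by metis
  have "\<exists>x\<in>X. \<forall>k::nat. \<exists>n\<ge>k. \<forall>i. \<bar>i\<bar> \<le> int k \<longrightarrow> x i = s n i"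
    by (rule limit_point) (use s(1) in_X_vertex in_X_edge in auto)
  then obtain x where x: "x \<in> X" "\<And>k::nat. \<exists>n\<ge>k. \<forall>i. \<bar>i\<bar> \<le> int k \<longrightarrow> x i = s n i" by blast
  obtain m where m: "depth A X \<pi> (word_at (\<pi> x) (- int m) (2 * m + 1)) \<le> enat k"
    using depth_window_le[OF assms[OF code_in_Y[OF x(1)]]] by blast
  obtain n where n: "n \<ge> m" "\<And>i. \<bar>i\<bar> \<le> int m \<Longrightarrow> x i = s n i" using x(2) by blast
  let ?y = "\<pi> (s n)"
  have "word_at ?y (- int m) (2 * m + 1) = word_at (\<pi> x) (- int m) (2 * m + 1)"
    by (rule word_at_eqI) (use n(2) in \<open>auto simp: code x(1) s(1)\<close>)
  moreover have "word_at ?y (- int n) (2 * n + 1) = word_at ?y (- int n) (n - m) @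
      word_at ?y (- int m) (2 * m + 1) @ word_at ?y (int m + 1) (n - m)"
  proof -
    have "2 * n + 1 = (n - m) + ((2 * m + 1) + (n - m))" using n(1) by simp
    moreover have "- int n + int (n - m) = - int m" "- int m + int (2 * m + 1) = int m + 1" using n(1) by auto
    ultimately show ?thesis by (simp only: word_at_append)
  qed
  ultimately have "depth A X \<pi> (word_at ?y (- int n) (2 * n + 1)) \<le> enat k"
    using depth_le_extend[OF m] by metis
  then show False using s(2) by blast
qed

text \<open>Stated for any \<open>g\<close> between t-depth and depth, because the way from words to classes uses t-depth
  and the way back produces depth.\<close>

lemma uniform_minimum_iff:
  assumes lower: "\<And>w. w \<in> language Y \<Longrightarrow> t_depth X \<pi> w \<le> g w" and upper: "\<And>w. g w \<le> depth A X \<pi> w"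
  shows "(\<exists>N>0. enat d = (INF w\<in>language Y. g w) \<and> (\<forall>w\<in>words Y N. g w = enat d)) \<longleftrightarrow>
    Y \<noteq> {} \<and> (\<forall>y\<in>Y. num_right_classes X \<pi> y = enat d)"
proof
  assume "\<exists>N>0. enat d = (INF w\<in>language Y. g w) \<and> (\<forall>w\<in>words Y N. g w = enat d)"
  then obtain N where N: "N > 0" "enat d = (INF w\<in>language Y. g w)" "\<And>w. w \<in> words Y N \<Longrightarrow> g w = enat d"
    by blast
  have "language Y \<noteq> {}" using N(2) by (auto simp: top_enat_def)
  then have "Y \<noteq> {}" by (auto simp: language_def words_def)
  moreover have "num_right_classes X \<pi> y = enat d" if y: "y \<in> Y" for y
  proof (rule antisym)
    have "t_depth X \<pi> (word_at y m N) \<le> enat d" for m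
      using N(1,3) word_at_in_words[OF y] words_in_language lower by (metis subsetD)
    then show "num_right_classes X \<pi> y \<le> enat d" using N(1) by (intro num_right_classes_le) blast
    show "enat d \<le> num_right_classes X \<pi> y"
    proof (rule enat_le_if_bounds)
      fix k assume "num_right_classes X \<pi> y \<le> enat k"
      then obtain n where "depth A X \<pi> (word_at y (- int n) (2 * n + 1)) \<le> enat k"
        using depth_window_le by blast
      moreover have "word_at y (- int n) (2 * n + 1) \<in> language Y"
        using word_at_in_words[OF y] words_in_language[of "2 * n + 1"] by auto
      ultimately show "enat d \<le> enat k" unfolding N(2) using upper by (meson INF_lower2 order_trans)
    qed
  qed
  ultimately show "Y \<noteq> {} \<and> (\<forall>y\<in>Y. num_right_classes X \<pi> y = enat d)" by blast
next
  assume *: "Y \<noteq> {} \<and> (\<forall>y\<in>Y. num_right_classes X \<pi> y = enat d)"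
  then obtain N where N: "N > 0" "\<And>w. w \<in> words Y N \<Longrightarrow> depth A X \<pi> w \<le> enat d"
    using uniform_depth_bound[of d] by auto
  have min: "enat d \<le> g w" if w: "w \<in> language Y" for w
  proof (rule enat_le_if_bounds)
    fix k assume "g w \<le> enat k"
    then have "t_depth X \<pi> w \<le> enat k" using lower[OF w] by (rule order_trans[rotated])
    then obtain y where "y \<in> Y" "num_right_classes X \<pi> y \<le> enat k" using few_classes_somewhere[OF w] by blast
    then show "enat d \<le> enat k" using * by metis
  qed
  have eq: "g w = enat d" if w: "w \<in> words Y N" for w
    using N(2)[OF w] upper[of w] min[of w] words_in_language[OF N(1)] w by (meson antisym order_trans subsetD)
  obtain y where "y \<in> Y" using * by blast
  then have w: "word_at y 0 N \<in> words Y N" by (rule word_at_in_words)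
  then have "(INF w\<in>language Y. g w) \<le> enat d"
    using eq[OF w] words_in_language[OF N(1)] by (metis INF_lower subsetD)
  moreover have "enat d \<le> (INF w\<in>language Y. g w)" using min by (rule INF_greatest)
  ultimately show "\<exists>N>0. enat d = (INF w\<in>language Y. g w) \<and> (\<forall>w\<in>words Y N. g w = enat d)"
    using N(1) eq by (intro exI[of _ N]) auto
qed

lemma constant_class_to_one_iff:
  "constant_class_to_one X Y \<pi> \<and> class_degree X Y \<pi> = enat d \<longleftrightarrow>
    Y \<noteq> {} \<and> (\<forall>y\<in>Y. num_right_classes X \<pi> y = enat d)"
proof (cases "Y = {}")
  case False
  have "(INF y\<in>Y. num_right_classes X \<pi> y) = enat d" if "\<forall>y\<in>Y. num_right_classes X \<pi> y = enat d"
    using that False by (simp cong: INF_cong)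
  with False show ?thesis unfolding constant_class_to_one_def class_degree_def by metis
qed (simp add: class_degree_def top_enat_def)

end

section \<open>Class-closing and continuing\<close>

context vertex_code
begin

text \<open>Compactness for paths over larger and larger windows that agree with \<open>x\<close> on a fixed set \<open>S\<close>. In
  the applications \<open>S\<close> is a half-line, so that the limit is asymptotic to \<open>x\<close>.\<close>

lemma limit_in_fibre:
  assumes "\<And>n. \<exists>t. (\<forall>i. t i \<in> Field E) \<and> (\<forall>i\<in>S. t i = x i) \<and>
    (\<forall>i. - int n \<le> i \<and> i < int n \<longrightarrow> (t i, t (i + 1)) \<in> E) \<and>
    (\<forall>i. - int n \<le> i \<and> i \<le> int n \<longrightarrow> f (t i) = y i)"
  shows "\<exists>z\<in>fibre X \<pi> y. \<forall>i\<in>S. z i = x i"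
proof -
  define good where "good n t \<longleftrightarrow> (\<forall>i. t i \<in> Field E) \<and> (\<forall>i\<in>S. t i = x i) \<and>
    (\<forall>i. - int n \<le> i \<and> i < int n \<longrightarrow> (t i, t (i + 1)) \<in> E) \<and>
    (\<forall>i. - int n \<le> i \<and> i \<le> int n \<longrightarrow> f (t i) = y i)" for n t
  have "\<forall>n. \<exists>t. good n t" using assms by (simp add: good_def)
  then obtain t where t: "\<And>n. good n (t n)" by metis
  have s: "t n i \<in> Field E" "i \<in> S \<Longrightarrow> t n i = x i"
    "- int n \<le> i \<Longrightarrow> i < int n \<Longrightarrow> (t n i, t n (i + 1)) \<in> E"
    "- int n \<le> i \<Longrightarrow> i \<le> int n \<Longrightarrow> f (t n i) = y i" for n i
    using t[of n] unfolding good_def by blast+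
  have "\<exists>z\<in>X. \<forall>k::nat. \<exists>n\<ge>k. \<forall>i. \<bar>i\<bar> \<le> int k \<longrightarrow> z i = t n i"
    by (rule limit_point) (use s(1,3) in auto)
  then obtain z where z: "z \<in> X" "\<And>k::nat. \<exists>n\<ge>k. \<forall>i. \<bar>i\<bar> \<le> int k \<longrightarrow> z i = t n i" by blast
  have at: "\<exists>n\<ge>nat \<bar>i\<bar>. z i = t n i" for i using z(2)[of "nat \<bar>i\<bar>"] by auto
  have "f (z i) = y i" for i
  proof -
    obtain n where "n \<ge> nat \<bar>i\<bar>" "z i = t n i" using at by blast
    then show ?thesis using s(4)[of n i] by auto
  qed
  then have "z \<in> fibre X \<pi> y" using z(1) by (simp add: in_fibre_iff)
  moreover have "\<forall>i\<in>S. z i = x i" using at s(2) by metis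
  ultimately show ?thesis by blast
qed

end

locale vertex_code_narrow = vertex_code_rank +
  fixes N :: nat
  assumes N_pos: "N > 0" and narrow_words: "w \<in> words Y N \<Longrightarrow> narrow w"
begin

lemma reach_narrow:
  assumes "y \<in> Y"
  obtains w where "narrow w" "steps w = reach y m (m + int N)"
  using that[of "word_at y (m + 1) N"] narrow_words[OF word_at_in_words[OF assms]]
  by (simp add: steps_word_at)

lemma reach_word:
  assumes "m \<le> n"
  obtains u where "steps u = reach y m n"
  using that by (simp add: reach_def)

text \<open>If the window lies to the right of the meeting time \<open>i\<close>, a narrow window ending at \<open>i\<close> is used
  as the first of the pair; if it lies to the left, one starting at \<open>i\<close> is used as the second.\<close>

lemma meeting_points_reach:
  assumes y: "y \<in> Y" and x: "x \<in> fibre X \<pi> y" "x' \<in> fibre X \<pi> y" and meet: "x i = x' i"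
    and m: "i \<le> m \<or> m + int N \<le> i"
  shows "(x m, x' (m + int N)) \<in> reach y m (m + int N)"
proof -
  note r = reach_fibre[OF x(1)] and r' = reach_fibre[OF x(2)]
  obtain w where w: "narrow w" "steps w = reach y m (m + int N)" using reach_narrow[OF y] .
  from m show ?thesis
  proof
    assume im: "i \<le> m"
    obtain w1 where w1: "narrow w1" "steps w1 = reach y (i - int N) i"
      using reach_narrow[OF y, of "i - int N"] by auto
    obtain u where u: "steps u = reach y i m" using reach_word[OF im] .
    have "(x m, x' (m + int N)) \<in> steps w"
    proof (rule merge_right[OF w1(1) w(1)])
      show "(x (i - int N), x i) \<in> steps w1" unfolding w1 by (rule r) simp
      show "(x i, x m) \<in> steps u" unfolding u by (rule r) (fact im)
      show "(x i, x' m) \<in> steps u" unfolding u meet by (rule r') (fact im)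
      show "(x m, x (m + int N)) \<in> steps w" unfolding w by (rule r) simp
      show "(x' m, x' (m + int N)) \<in> steps w" unfolding w by (rule r') simp
    qed
    then show ?thesis unfolding w .
  next
    assume im: "m + int N \<le> i"
    obtain w2 where w2: "narrow w2" "steps w2 = reach y i (i + int N)" using reach_narrow[OF y] .
    obtain u where u: "steps u = reach y (m + int N) i" using reach_word[OF im] .
    have "(x m, x' (m + int N)) \<in> steps w"
    proof (rule merge_left[OF w(1) w2(1)])
      show "(x m, x (m + int N)) \<in> steps w" unfolding w by (rule r) simp
      show "(x' m, x' (m + int N)) \<in> steps w" unfolding w by (rule r') simp
      show "(x (m + int N), x i) \<in> steps u" unfolding u by (rule r) (fact im)
      show "(x' (m + int N), x i) \<in> steps u" unfolding u meet by (rule r') (fact im)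
      show "(x i, x (i + int N)) \<in> steps w2" unfolding w2 by (rule r) simp
    qed
    then show ?thesis unfolding w .
  qed
qed

text \<open>Asymptotic points agree at some time, and agreement at one time suffices.\<close>

lemma bi_class_closing: "bi_class_closing X \<pi>"
proof -
  have right: "right_reach X \<pi> x x'"
    if y: "y \<in> Y" and x: "x \<in> fibre X \<pi> y" "x' \<in> fibre X \<pi> y" and meet: "x i = x' i" for x x' y i
    unfolding right_reach_iff[OF x]
  proof
    fix m
    let ?m = "max m i"
    have "(x m, x ?m) \<in> reach y m ?m" using reach_fibre[OF x(1)] by simp
    moreover have "(x ?m, x' (?m + int N)) \<in> reach y ?m (?m + int N)"
      by (rule meeting_points_reach[OF y x meet]) simp
    ultimately have "(x m, x' (?m + int N)) \<in> reach y m (?m + int N)" by (rule reach_trans) auto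
    then show "\<exists>n>m. (x m, x' n) \<in> reach y m n" using N_pos by (intro exI[of _ "?m + int N"]) auto
  qed
  have left: "left_reach X \<pi> x x'"
    if y: "y \<in> Y" and x: "x \<in> fibre X \<pi> y" "x' \<in> fibre X \<pi> y" and meet: "x i = x' i" for x x' y i
    unfolding left_reach_iff[OF x]
  proof
    fix m
    let ?m = "min m i"
    have "(x' (?m - int N), x (?m - int N + int N)) \<in> reach y (?m - int N) (?m - int N + int N)"
      by (rule meeting_points_reach[OF y x(2,1) meet[symmetric]]) simp
    then have "(x' (?m - int N), x ?m) \<in> reach y (?m - int N) ?m" by simp
    moreover have "(x ?m, x m) \<in> reach y ?m m" using reach_fibre[OF x(1)] by simp
    ultimately have "(x' (?m - int N), x m) \<in> reach y (?m - int N) m" by (rule reach_trans) auto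
    then show "\<exists>n<m. (x' n, x m) \<in> reach y n m" using N_pos by (intro exI[of _ "?m - int N"]) auto
  qed
  show ?thesis
    unfolding bi_class_closing_def right_class_closing_def left_class_closing_def
      left_asymptotic_def right_asymptotic_def right_equivalent_def left_equivalent_def
  proof (intro conjI ballI impI)
    fix x x' assume X: "x \<in> X" "x' \<in> X" and asym: "\<exists>n. \<forall>i\<le>n. x i = x' i" and eq: "\<pi> x = \<pi> x'"
    have "x \<in> fibre X \<pi> (\<pi> x)" "x' \<in> fibre X \<pi> (\<pi> x)" using X eq by (auto simp: fibre_def)
    moreover obtain n where "x n = x' n" using asym by blast
    ultimately show "right_reach X \<pi> x x'" "right_reach X \<pi> x' x"
      using right[OF code_in_Y[OF X(1)]] by metis+
  next
    fix x x' assume X: "x \<in> X" "x' \<in> X" and asym: "\<exists>n. \<forall>i\<ge>n. x i = x' i" and eq: "\<pi> x = \<pi> x'"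
    have "x \<in> fibre X \<pi> (\<pi> x)" "x' \<in> fibre X \<pi> (\<pi> x)" using X eq by (auto simp: fibre_def)
    moreover obtain n where "x n = x' n" using asym by blast
    ultimately show "left_reach X \<pi> x x'" "left_reach X \<pi> x' x"
      using left[OF code_in_Y[OF X(1)]] by metis+
  qed auto
qed

lemma reach_extend:
  assumes y: "y \<in> Y" and mq: "m + int N \<le> q"
  shows "Domain (reach y m (m + int N)) \<subseteq> Domain (reach y m (q + int N))"
    and "Range (reach y q (q + int N)) \<subseteq> Range (reach y m (q + int N))"
proof -
  obtain w1 where w1: "narrow w1" "steps w1 = reach y m (m + int N)" using reach_narrow[OF y] .
  obtain w2 where w2: "narrow w2" "steps w2 = reach y q (q + int N)" using reach_narrow[OF y] .
  obtain u where u: "steps u = reach y (m + int N) q" using reach_word[OF mq] .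
  have eq: "steps (w1 @ u @ w2) = reach y m (q + int N)"
    unfolding label_steps_append w1 w2 u using mq by (simp add: reach_comp)
  obtain x where "x \<in> fibre X \<pi> y" using y by (auto simp: Y_eq fibre_def)
  then have "steps (w1 @ u @ w2) \<noteq> {}"
    unfolding eq using reach_fibre[of x y m "q + int N"] mq by auto
  from Domain_steps_extend[OF w1(1) w2(1) this] Range_steps_extend[OF w1(1) w2(1) this]
  show "Domain (reach y m (m + int N)) \<subseteq> Domain (reach y m (q + int N))"
    "Range (reach y q (q + int N)) \<subseteq> Range (reach y m (q + int N))"
    unfolding eq unfolding w1 w2 .
qed

text \<open>Where \<open>y\<close> still agrees with \<open>\<pi> x\<close>, the point \<open>x\<close> itself provides a path across a narrow window.
  It extends over any longer stretch of \<open>y\<close>, and a limit of the extensions is the required preimage.\<close>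

lemma right_continuing: "right_continuing X Y \<pi>"
  unfolding right_continuing_def
proof (intro ballI impI)
  fix x y assume x: "x \<in> X" and y: "y \<in> Y" and asym: "left_asymptotic y (\<pi> x)"
  obtain n0 where n0: "\<And>i. i \<le> n0 \<Longrightarrow> y i = \<pi> x i" using asym by (auto simp: left_asymptotic_def)
  define m where "m = n0 - int N"
  have "\<exists>z\<in>fibre X \<pi> y. \<forall>i\<in>{..m}. z i = x i"
  proof (rule limit_in_fibre)
    fix n
    define q where "q = max n0 (int n)"
    have q: "m + int N \<le> q" "m \<le> q + int N" "int n \<le> q + int N" by (auto simp: q_def m_def)
    have "(x m, x (m + int N)) \<in> reach y m (m + int N)"
      by (rule reach_point[OF x]) (auto simp: m_def n0)
    then obtain c where "(x m, c) \<in> reach y m (q + int N)" using reach_extend(1)[OF y q(1)] by blast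
    from path_of_reach[OF q(2) this] obtain p where p: "p m = x m"
      "\<And>i. m \<le> i \<Longrightarrow> i < q + int N \<Longrightarrow> (p i, p (i + 1)) \<in> E"
      "\<And>i. m < i \<Longrightarrow> i \<le> q + int N \<Longrightarrow> f (p i) = y i" by blast
    define t where "t i = (if m \<le> i \<and> i \<le> q + int N then p i else x i)" for i
    have tx: "t i = x i" if "i \<le> m" for i using that p(1) by (auto simp: t_def)
    have e: "(t i, t (i + 1)) \<in> E" if "i < q + int N" for i
    proof (cases "i < m")
      case True
      then show ?thesis using in_X_edge[OF x] by (simp add: tx)
    next
      case False
      then show ?thesis using p(2)[of i] that by (simp add: t_def)
    qed
    have "t i \<in> Field E" for i
    proof (cases "m < i \<and> i \<le> q + int N")
      case True
      then show ?thesis using e[of "i - 1"] by (auto simp: Field_def)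
    next
      case False
      then show ?thesis using in_X_vertex[OF x] tx[of i] by (auto simp: t_def)
    qed
    moreover have "f (t i) = y i" if "i \<le> q + int N" for i
    proof (cases "i \<le> m")
      case True
      then show ?thesis using n0[of i] code[OF x] by (simp add: tx m_def)
    next
      case False
      then show ?thesis using p(3)[of i] that by (simp add: t_def)
    qed
    ultimately show "\<exists>t. (\<forall>i. t i \<in> Field E) \<and> (\<forall>i\<in>{..m}. t i = x i) \<and>
      (\<forall>i. - int n \<le> i \<and> i < int n \<longrightarrow> (t i, t (i + 1)) \<in> E) \<and>
      (\<forall>i. - int n \<le> i \<and> i \<le> int n \<longrightarrow> f (t i) = y i)"
      using e tx q(3) by (intro exI[of _ t]) auto
  qed
  then show "\<exists>x'\<in>fibre X \<pi> y. left_asymptotic x' x" by (auto simp: left_asymptotic_def)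
qed

lemma left_continuing: "left_continuing X Y \<pi>"
  unfolding left_continuing_def
proof (intro ballI impI)
  fix x y assume x: "x \<in> X" and y: "y \<in> Y" and asym: "right_asymptotic y (\<pi> x)"
  obtain n0 where n0: "\<And>i. n0 \<le> i \<Longrightarrow> y i = \<pi> x i" using asym by (auto simp: right_asymptotic_def)
  have "\<exists>z\<in>fibre X \<pi> y. \<forall>i\<in>{n0 + int N..}. z i = x i"
  proof (rule limit_in_fibre)
    fix n
    \<comment> \<open>Labels are read after the first vertex only, so the path must start strictly to the left of the window.\<close>
    define m where "m = min (n0 - int N) (- int n) - 1"
    have m: "m + int N \<le> n0" "m \<le> n0 + int N" "m < - int n" by (auto simp: m_def)
    have "(x n0, x (n0 + int N)) \<in> reach y n0 (n0 + int N)"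
      by (rule reach_point[OF x]) (auto simp: n0)
    then obtain a where "(a, x (n0 + int N)) \<in> reach y m (n0 + int N)" using reach_extend(2)[OF y m(1)] by blast
    from path_of_reach[OF m(2) this] obtain p where p: "p (n0 + int N) = x (n0 + int N)"
      "\<And>i. m \<le> i \<Longrightarrow> i < n0 + int N \<Longrightarrow> (p i, p (i + 1)) \<in> E"
      "\<And>i. m < i \<Longrightarrow> i \<le> n0 + int N \<Longrightarrow> f (p i) = y i" by blast
    define t where "t i = (if m \<le> i \<and> i \<le> n0 + int N then p i else x i)" for i
    have tx: "t i = x i" if "n0 + int N \<le> i" for i using that p(1) by (auto simp: t_def)
    have e: "(t i, t (i + 1)) \<in> E" if "m \<le> i" for i
    proof (cases "n0 + int N \<le> i")
      case True
      then show ?thesis using in_X_edge[OF x] by (simp add: tx)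
    next
      case False
      then show ?thesis using p(2)[of i] that by (simp add: t_def)
    qed
    have "t i \<in> Field E" for i
    proof (cases "m \<le> i")
      case True
      then show ?thesis using e[of i] by (auto simp: Field_def)
    next
      case False
      then show ?thesis using in_X_vertex[OF x] by (auto simp: t_def)
    qed
    moreover have "f (t i) = y i" if "m < i" for i
    proof (cases "n0 + int N \<le> i")
      case True
      then show ?thesis using n0[of i] code[OF x] by (simp add: tx)
    next
      case False
      then show ?thesis using p(3)[of i] that by (simp add: t_def)
    qed
    ultimately show "\<exists>t. (\<forall>i. t i \<in> Field E) \<and> (\<forall>i\<in>{n0 + int N..}. t i = x i) \<and>
      (\<forall>i. - int n \<le> i \<and> i < int n \<longrightarrow> (t i, t (i + 1)) \<in> E) \<and>
      (\<forall>i. - int n \<le> i \<and> i \<le> int n \<longrightarrow> f (t i) = y i)"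
      using e tx m(3) by (intro exI[of _ t]) auto
  qed
  then show "\<exists>x'\<in>fibre X \<pi> y. right_asymptotic x' x" by (auto simp: right_asymptotic_def)
qed

end

context vertex_code
begin

lemma closing_and_continuing:
  assumes "\<And>w. w \<in> language Y \<Longrightarrow> enat d \<le> t_depth X \<pi> w" "N > 0"
    and "\<And>w. w \<in> words Y N \<Longrightarrow> depth A X \<pi> w \<le> enat d"
  shows "bi_class_closing X \<pi> \<and> bi_continuing X Y \<pi>"
proof -
  interpret R: vertex_code_rank A X Y \<pi> E d
    by unfold_locales (use steps_boolean_rank[OF assms(1)] in blast)
  interpret R: vertex_code_narrow A X Y \<pi> E d N
    by unfold_locales (use assms(2) depth_le_routes[OF assms(3)] in \<open>auto simp: R.narrow_def\<close>)
  show ?thesis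
    using R.bi_class_closing R.right_continuing R.left_continuing by (simp add: bi_continuing_def)
qed

end

section \<open>Presentation of the code by a labelled graph\<close>

text \<open>A basic neighbourhood in the product topology restricts only finitely many coordinates.\<close>

lemma closed_window_limit:
  assumes "shift_space A X" and "\<And>i. x i \<in> A"
    and window: "\<And>n. \<exists>z\<in>X. \<forall>i. \<bar>i\<bar> \<le> int n \<longrightarrow> z i = x i"
  shows "x \<in> X"
proof (rule ccontr)
  assume "x \<notin> X"
  have cl: "closedin (full_shift A) X" using assms(1) by (simp add: shift_space_def)
  have top: "topspace (full_shift A) = {z. \<forall>i. z i \<in> A}"
    by (auto simp: full_shift_def PiE_def extensional_def)
  let ?C = "topspace (full_shift A) - X"
  have "openin (full_shift A) ?C" using cl by blast
  then have nbhd: "\<forall>z\<in>?C. \<exists>U. finite {i \<in> UNIV. U i \<noteq> topspace (discrete_topology A)} \<and>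
      (\<forall>i\<in>UNIV. openin (discrete_topology A) (U i)) \<and> z \<in> Pi\<^sub>E UNIV U \<and> Pi\<^sub>E UNIV U \<subseteq> ?C"
    unfolding full_shift_def by (rule iffD1[OF openin_product_topology_alt])
  have "x \<in> ?C" using \<open>x \<notin> X\<close> assms(2) top by auto
  from bspec[OF nbhd this] obtain U where U': "finite {i \<in> UNIV. U i \<noteq> topspace (discrete_topology A)}"
    and U: "x \<in> Pi\<^sub>E UNIV U" "Pi\<^sub>E UNIV U \<subseteq> ?C" by blast
  have fin: "finite {i. U i \<noteq> A}" using U' by simp
  obtain n where n: "\<And>i. U i \<noteq> A \<Longrightarrow> \<bar>i\<bar> \<le> int n"
  proof
    fix i assume "U i \<noteq> A"
    then have "\<bar>i\<bar> \<le> Max (insert 0 (abs ` {i. U i \<noteq> A}))" using fin by (intro Max_ge) auto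
    then show "\<bar>i\<bar> \<le> int (nat (Max (insert 0 (abs ` {i. U i \<noteq> A}))))" by linarith
  qed
  obtain z where z: "z \<in> X" "\<And>i. \<bar>i\<bar> \<le> int n \<Longrightarrow> z i = x i" using window by blast
  have "z i \<in> U i" for i
  proof (cases "U i = A")
    case True
    then show ?thesis using z(1) closedin_subset[OF cl] top by auto
  next
    case False
    then show ?thesis using n z(2)[of i] U(1) by (auto simp: PiE_def Pi_def)
  qed
  then have "z \<in> Pi\<^sub>E UNIV U" by auto
  then show False using U(2) z(1) by auto
qed

lemma shift_space_shift:
  assumes "shift_space A X" "x \<in> X"
  shows "(\<lambda>i. x (i + j)) \<in> X"
proof -
  have im: "shift_map ` X = X" using assms(1) by (simp add: shift_space_def)
  show ?thesis
  proof (induction j rule: int_induct[of _ 0])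
    case (step1 j)
    then have "shift_map (\<lambda>i. x (i + j)) \<in> X" using im by blast
    then show ?case by (simp add: shift_map_def algebra_simps)
  next
    case (step2 j)
    then obtain z where z: "z \<in> X" "(\<lambda>i. x (i + j)) = shift_map z" using im by blast
    have "z i = x (i + (j - 1))" for i
      using fun_cong[OF z(2), of "i - 1"] by (simp add: shift_map_def algebra_simps)
    then have "z = (\<lambda>i. x (i + (j - 1)))" by (rule ext)
    then show ?case using z(1) by simp
  qed (use assms(2) in simp)
qed

definition edges :: "(int \<Rightarrow> 'a) set \<Rightarrow> ('a \<times> 'a) set" where
  "edges X = {(x 0, x 1) | x. x \<in> X}"

lemma edges_at:
  assumes "shift_space A X" "x \<in> X"
  shows "(x i, x (i + 1)) \<in> edges X"
  using shift_space_shift[OF assms, of i] unfolding edges_def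
  by (auto intro!: exI[of _ "\<lambda>k. x (k + i)"] simp: add.commute)

lemma in_shift_alphabet:
  assumes "shift_space A X" "x \<in> X"
  shows "x i \<in> A"
  using assms closedin_subset unfolding shift_space_def full_shift_def by fastforce

lemma word_in_language: "x \<in> X \<Longrightarrow> n > 0 \<Longrightarrow> word_at x i n \<in> language X"
  unfolding language_def words_def by (auto intro!: bexI[of _ n])

lemma language_path:
  assumes "shift_space A X" "u \<in> language X"
  shows "successively (\<lambda>a c. (a, c) \<in> edges X) u"
proof -
  obtain x i n where x: "x \<in> X" "u = word_at x i n" using assms(2) by (auto simp: language_def words_def)
  show ?thesis unfolding successively_conv_nth
  proof (intro allI impI)
    fix k assume "Suc k < length u"
    then show "(u ! k, u ! Suc k) \<in> edges X"
      using edges_at[OF assms(1) x(1), of "i + int k"] by (simp add: x(2) algebra_simps)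
  qed
qed

text \<open>The 1-step condition glues the 2-letter words one after the other.\<close>

lemma path_language:
  assumes sft: "one_step_sft A X"
  shows "successively (\<lambda>a c. (a, c) \<in> edges X) (a # c # u) \<Longrightarrow> a # c # u \<in> language X"
proof (induction u arbitrary: a c)
  case Nil
  then obtain x where "x \<in> X" "a = x 0" "c = x 1" by (auto simp: edges_def)
  then show ?case using word_in_language[of x X 2 0] by (simp add: word_at_def numeral_2_eq_2)
next
  case (Cons e u)
  then have ce: "[c] @ (e # u) \<in> language X" by simp
  obtain x where x: "x \<in> X" "a = x 0" "c = x 1" using Cons.prems by (auto simp: edges_def)
  have "[a] @ [c] \<in> language X"
    using x word_in_language[of x X 2 0] by (simp add: word_at_def numeral_2_eq_2)
  moreover have "[c] \<in> words X 1"
    unfolding words_def using x by (auto intro!: exI[of _ x] exI[of _ 1] simp: word_at_def)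
  ultimately have "[a] @ [c] @ (e # u) \<in> language X"
    using sft ce unfolding one_step_sft_def by blast
  then show ?case by simp
qed

lemma one_step_sft_iff_edges:
  assumes sft: "one_step_sft A X"
  shows "x \<in> X \<longleftrightarrow> (\<forall>i. (x i, x (i + 1)) \<in> edges X)"
proof
  have ss: "shift_space A X" using sft by (simp add: one_step_sft_def)
  show "\<forall>i. (x i, x (i + 1)) \<in> edges X" if "x \<in> X" using edges_at[OF ss that] by blast
  assume e: "\<forall>i. (x i, x (i + 1)) \<in> edges X"
  show "x \<in> X"
  proof (rule closed_window_limit[OF ss])
    show "x i \<in> A" for i
    proof -
      obtain z where "z \<in> X" "x i = z 0" using e[rule_format, of i] by (auto simp: edges_def)
      then show ?thesis using in_shift_alphabet[OF ss] by metis
    qed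
    fix n
    have "successively (\<lambda>a c. (a, c) \<in> edges X) (word_at x (- int n) (2 * n + 2))"
      unfolding successively_conv_nth
    proof (intro allI impI)
      fix k assume "Suc k < length (word_at x (- int n) (2 * n + 2))"
      then show "(word_at x (- int n) (2 * n + 2) ! k, word_at x (- int n) (2 * n + 2) ! Suc k) \<in> edges X"
        using e[rule_format, of "- int n + int k"] by (simp add: algebra_simps)
    qed
    moreover obtain a c u where acu: "word_at x (- int n) (2 * n + 2) = a # c # u"
      by (metis add_2_eq_Suc' length_Suc_conv length_word_at)
    ultimately have "word_at x (- int n) (2 * n + 2) \<in> language X"
      using path_language[OF sft] by simp
    then obtain z i k where z: "z \<in> X" "word_at x (- int n) (2 * n + 2) = word_at z i k"
      by (auto simp: language_def words_def)
    then have k: "k = 2 * n + 2" by (metis length_word_at)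
    have "(\<lambda>j. z (j + (i + int n))) \<in> X" using shift_space_shift[OF ss z(1)] .
    moreover have "z (j + (i + int n)) = x j" if j: "\<bar>j\<bar> \<le> int n" for j
    proof -
      have "nat (j + int n) < 2 * n + 2" "0 \<le> j + int n" using j by linarith+
      then have "word_at x (- int n) (2 * n + 2) ! nat (j + int n) = x j"
        "word_at z i k ! nat (j + int n) = z (i + (j + int n))"
        using k by simp_all
      then show ?thesis using z(2) by (simp add: algebra_simps)
    qed
    ultimately show "\<exists>z\<in>X. \<forall>i. \<bar>i\<bar> \<le> int n \<longrightarrow> z i = x i"
      by (intro bexI[of _ "\<lambda>j. z (j + (i + int n))"]) auto
  qed
qed

lemma successively_trancl:
  assumes "successively (\<lambda>a c. (a, c) \<in> E) (a # u)" "u \<noteq> []"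
  shows "(a, last u) \<in> E\<^sup>+"
  using assms
proof (induction u arbitrary: a)
  case (Cons c u)
  then show ?case by (cases "u = []") (auto intro: trancl_into_trancl2)
qed simp

lemma irreducible_edges_connected:
  assumes ss: "shift_space A X" and irr: "irreducible_shift X"
    and "a \<in> Field (edges X)" "c \<in> Field (edges X)"
  shows "(a, c) \<in> (edges X)\<^sup>+"
proof -
  have "[a] \<in> language X" if "a \<in> Field (edges X)" for a
  proof -
    obtain x i where "x \<in> X" "a = x i"
      using \<open>a \<in> Field (edges X)\<close> by (auto simp: Field_def edges_def)
    then show ?thesis using word_in_language[of x X 1 i] by (simp add: word_at_def)
  qed
  then obtain w where "[a] @ w @ [c] \<in> language X"
    using irr assms(3,4) unfolding irreducible_shift_def by blast
  from language_path[OF ss this] have "successively (\<lambda>a c. (a, c) \<in> edges X) (a # w @ [c])" by simp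
  from successively_trancl[OF this] show ?thesis by simp
qed

text \<open>The assumption speaks about coordinate 0 only; commutation with all powers of the shift, also the
  negative ones, carries it to coordinate \<open>i\<close>.\<close>

lemma one_block_symbol_map:
  assumes ss: "shift_space A X" and fc: "factor_code A X B Y \<pi>" and ob: "one_block X \<pi>" and x: "x \<in> X"
  shows "\<pi> x i = symbol_map X \<pi> (x i)"
proof -
  have zero: "\<pi> z 0 = symbol_map X \<pi> (z 0)" if z: "z \<in> X" for z
    unfolding symbol_map_def
  proof (rule the_equality[symmetric])
    show "\<exists>x\<in>X. x 0 = z 0 \<and> \<pi> x 0 = \<pi> z 0" using z by blast
    show "b = \<pi> z 0" if "\<exists>x\<in>X. x 0 = z 0 \<and> \<pi> x 0 = b" for b
      using that z ob unfolding one_block_def by blast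
  qed
  have comm: "\<pi> (\<lambda>i. z (i + 1)) = (\<lambda>i. \<pi> z (i + 1))" if "z \<in> X" for z
    using fc that by (simp add: factor_code_def shift_map_def)
  have "\<pi> (\<lambda>i. x (i + j)) = (\<lambda>i. \<pi> x (i + j))" for j
  proof (induction j rule: int_induct[of _ 0])
    case (step1 j)
    then show ?case using comm[OF shift_space_shift[OF ss x, of j]] by (simp add: add.commute add.left_commute fun_eq_iff)
  next
    case (step2 j)
    let ?z = "\<lambda>i. x (i + (j - 1))"
    have "(\<lambda>i. ?z (i + 1)) = (\<lambda>i. x (i + j))" by (simp add: algebra_simps)
    then have "(\<lambda>i. \<pi> ?z (i + 1)) = (\<lambda>i. \<pi> x (i + j))"
      using comm[OF shift_space_shift[OF ss x, of "j - 1"]] step2(2) by simp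
    then have "\<pi> ?z i = \<pi> x (i + (j - 1))" for i
      using fun_cong[of "\<lambda>i. \<pi> ?z (i + 1)" "\<lambda>i. \<pi> x (i + j)" "i - 1"] by (simp add: algebra_simps)
    then show ?case by (rule ext)
  qed simp
  then show ?thesis using zero[OF shift_space_shift[OF ss x, of i]] by (simp add: fun_eq_iff)
qed

section \<open>The equivalence\<close>

theorem theorem5p3:
  fixes A :: "'a set" and X :: "(int \<Rightarrow> 'a) set"
    and B :: "'b set" and Y :: "(int \<Rightarrow> 'b) set"
    and \<pi> :: "(int \<Rightarrow> 'a) \<Rightarrow> (int \<Rightarrow> 'b)" and d :: nat
  assumes "one_step_sft A X" and "irreducible_shift X"
    and "sofic_shift B Y"
    and "factor_code A X B Y \<pi>" and "one_block X \<pi>"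
    and "d > 0"
  shows "let
      C1 = (constant_class_to_one X Y \<pi> \<and> class_degree X Y \<pi> = enat d);
      C2 = (\<exists>N>0. enat d = (INF w\<in>language Y. depth A X \<pi> w) \<and>
              (\<forall>w\<in>words Y N. depth A X \<pi> w = enat d));
      C3 = (\<exists>N>0. enat d = (INF w\<in>language Y. t_depth X \<pi> w) \<and>
              (\<forall>w\<in>words Y N. t_depth X \<pi> w = enat d))
    in (C1 \<longleftrightarrow> C2) \<and> (C2 \<longleftrightarrow> C3) \<and>
       (C1 \<or> C2 \<or> C3 \<longrightarrow> bi_class_closing X \<pi> \<and> bi_continuing X Y \<pi>)"
proof -
  have ss: "shift_space A X" using assms(1) by (simp add: one_step_sft_def)
  interpret vertex_code A X Y \<pi> "edges X"
  proof
    show "finite A" using ss by (simp add: shift_space_def)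
    show "Field (edges X) \<subseteq> A" using in_shift_alphabet[OF ss] by (auto simp: Field_def edges_def)
    show "x \<in> X \<longleftrightarrow> (\<forall>i. (x i, x (i + 1)) \<in> edges X)" for x
      by (rule one_step_sft_iff_edges[OF assms(1)])
    show "(a, c) \<in> (edges X)\<^sup>+" if "a \<in> Field (edges X)" "c \<in> Field (edges X)" for a c
      using irreducible_edges_connected[OF ss assms(2) that] .
    show "\<pi> x i = symbol_map X \<pi> (x i)" if "x \<in> X" for x i
      using one_block_symbol_map[OF ss assms(4,5) that] .
    show "Y = \<pi> ` X" using assms(4) by (simp add: factor_code_def)
  qed
  let ?P = "Y \<noteq> {} \<and> (\<forall>y\<in>Y. num_right_classes X \<pi> y = enat d)"
  let ?C2 = "\<exists>N>0. enat d = (INF w\<in>language Y. depth A X \<pi> w) \<and> (\<forall>w\<in>words Y N. depth A X \<pi> w = enat d)"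
  let ?C3 = "\<exists>N>0. enat d = (INF w\<in>language Y. t_depth X \<pi> w) \<and> (\<forall>w\<in>words Y N. t_depth X \<pi> w = enat d)"
  have C1: "constant_class_to_one X Y \<pi> \<and> class_degree X Y \<pi> = enat d \<longleftrightarrow> ?P"
    by (rule constant_class_to_one_iff)
  have C2: "?C2 \<longleftrightarrow> ?P" by (rule uniform_minimum_iff) (rule t_depth_le_depth order_refl)+
  have C3: "?C3 \<longleftrightarrow> ?P" by (rule uniform_minimum_iff) (rule t_depth_le_depth order_refl)+
  have "bi_class_closing X \<pi> \<and> bi_continuing X Y \<pi>" if P: ?P
  proof -
    obtain N where N: "N > 0" "\<And>w. w \<in> words Y N \<Longrightarrow> depth A X \<pi> w = enat d" using C2 P by blast
    have "enat d = (INF w\<in>language Y. t_depth X \<pi> w)" using C3 P by blast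
    then have "enat d \<le> t_depth X \<pi> w" if "w \<in> language Y" for w using that by (metis INF_lower)
    then show ?thesis by (rule closing_and_continuing[OF _ N(1)]) (simp_all add: N(2))
  qed
  then show ?thesis unfolding Let_def C1 C2 C3 by blast
qed

end
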